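(* Let $m\ge2$ and consider an antisymmetric random walk on the free group $F_m$ generated by a probability measure $\mu$ with support equal to the set $\{a_i,\ a_i^{-1},\ a_1a_2,\ a_1^{-1}a_2^{-1}\}_{1\le i\le m}$, and let $\nu$ be its hitting measure on $\partial F_m$. Then $$\rho_\mu(a_1)=F_\mu(e,a_1)<\frac{\nu(C(a_1))}{1-\nu(C(a_1))},$$ and $$\rho_\mu(a_j)=F_\mu(e,a_j)=\frac{\nu(C(a_j))}{1-\nu(C(a_j))}\quad\text{for all } j>1.$$ In particular, such random walks do not satisfy the inequality $$\sum_{i=1}^m\left(\frac{1}{1+\rho_\mu(a_i)^{-1}}+\frac{1}{1+\rho_\mu(a_i^{-1})^{-1}}\right)\ge1.$$
   Context: $F_m$ is the free group on $a_1,\dots,a_m$. The random walk generated by $\mu$ is $X_{k+1}=X_ks_{k+1}$ with $s_1,s_2,\dots$ i.i.d. of law $\mu$; $\mathbb P_x$ denotes its law when $X_0=x$. Antisymmetric: let $g\mapsto\hat g$ be the automorphism of $F_m$ determined by $\hat a_i=a_i^{-1}$ for all $i$; the walk is antisymmetric if $\mu(g)=\mu(\hat g)$ for every $g\in F_m$. Almost every sample path started at $e$ converges to a point of $\partial F_m$ (the space of geodesic rays in the Cayley tree starting from $e$); the hitting measure $\nu$ is the law of the limit point. $C(g)\subset\partial F_m$ is the set of geodesic rays starting from the identity and containing $g$. First-passage function: $F_\mu(x,y)=\sum_{k\ge0}\mathbb P_x(X_k=y,\ X_j\ne y\text{ for }j<k)$. Also $\rho_\mu(g):=\liminf_{k\to\infty}F_\mu(e,g^k)^{1/k}$.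 *)

theory Defs
  imports "HOL-Probability.Probability" "HOL-Algebra.Group"
begin

(* The letter (i, True) stands for a_i and (i, False) for its inverse. *)

type_synonym letter = "nat \<times> bool"
type_synonym word = "letter list"

definition flip :: "letter \<Rightarrow> letter" where
  "flip x = (fst x, \<not> snd x)"

definition reduced_word :: "word \<Rightarrow> bool" where
  "reduced_word w \<longleftrightarrow> successively (\<lambda>x y. y \<noteq> flip x) w"

definition push :: "letter \<Rightarrow> word \<Rightarrow> word" where
  "push x w = (case w of [] \<Rightarrow> [x] | y # ys \<Rightarrow> if y = flip x then ys else x # w)"

(* For reduced words u and v, foldr push u v is the reduced form of u @ v. *)

definition free_group :: "nat \<Rightarrow> word monoid" where
  "free_group m =
     \<lparr>carrier = {w. reduced_word w \<and> fst ` set w \<subseteq> {1..m}}, mult = foldr push, one = []\<rparr>"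

definition gen :: "nat \<Rightarrow> word" where
  "gen i = [(i, True)]"

lemma flip_flip [simp]: "flip (flip x) = x"
  by (simp add: flip_def)

lemma flip_neq [simp]: "flip x \<noteq> x" "x \<noteq> flip x"
  by (auto simp: flip_def prod_eq_iff)

lemma flip_eq_iff [simp]: "flip x = flip y \<longleftrightarrow> x = y"
  by (metis flip_flip)

lemma fst_flip [simp]: "fst (flip x) = fst x"
  by (simp add: flip_def)

lemma reduced_Nil [simp]: "reduced_word []"
  by (simp add: reduced_word_def)

lemma reduced_Cons: "reduced_word (x # w) \<longleftrightarrow> reduced_word w \<and> (w = [] \<or> hd w \<noteq> flip x)"
  by (auto simp: reduced_word_def successively_Cons)

lemma reduced_push: "reduced_word w \<Longrightarrow> reduced_word (push x w)"
  by (auto simp: push_def reduced_Cons split: list.splits)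

lemma push_flip: "reduced_word w \<Longrightarrow> push (flip x) (push x w) = w"
  by (auto simp: push_def reduced_Cons split: list.splits)

lemma reduced_mult: "reduced_word v \<Longrightarrow> reduced_word (foldr push u v)"
  by (induction u) (auto intro: reduced_push)

lemma set_mult: "fst ` set (foldr push u v) \<subseteq> fst ` set u \<union> fst ` set v"
proof (induction u)
  case (Cons x u)
  have "fst ` set (push x w) \<subseteq> insert (fst x) (fst ` set w)" for w
    by (auto simp: push_def split: list.splits if_splits)
  then have "fst ` set (foldr push (x # u) v) \<subseteq> insert (fst x) (fst ` set (foldr push u v))"
    by simp
  also have "\<dots> \<subseteq> insert (fst x) (fst ` set u \<union> fst ` set v)"
    using Cons.IH by blast
  finally show ?case by simp
qed simp

lemma mult_push: 
  assumes "reduced_word u" "reduced_word v"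
  shows "foldr push (push x u) v = push x (foldr push u v)"
proof (cases "u \<noteq> [] \<and> hd u = flip x")
  case True
  then obtain us where u: "u = flip x # us" by (cases u) auto
  have "push x (push (flip x) (foldr push us v)) = foldr push us v"
    using push_flip[OF reduced_mult[OF assms(2)], of "flip x" us] by simp
  then show ?thesis by (simp add: u push_def[of x "flip x # us"])
next
  case False
  then have "push x u = x # u" by (cases u) (auto simp: push_def)
  then show ?thesis by simp
qed

lemma mult_assoc:
  assumes "reduced_word v" "reduced_word w"
  shows "foldr push (foldr push u v) w = foldr push u (foldr push v w)"
  by (induction u) (simp_all add: mult_push reduced_mult assms)

lemma mult_Nil: "reduced_word u \<Longrightarrow> foldr push u [] = u"
  by (induction u) (auto simp: reduced_Cons push_def split: list.splits)

lemma mult_inverse: "foldr push (rev (map flip w) @ w) [] = []"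
proof (induction w)
  case (Cons x w)
  have "push (flip x) (push x (foldr push w [])) = foldr push w []"
    by (intro push_flip reduced_mult) simp
  with Cons show ?case by simp
qed simp

lemma reduced_inverse: "reduced_word w \<Longrightarrow> reduced_word (rev (map flip w))"
  unfolding reduced_word_def successively_rev successively_map
  by (erule successively_mono) (auto simp: flip_def prod_eq_iff)

lemma group_free_group: "group (free_group m)"
proof (rule groupI)
  fix x assume x: "x \<in> carrier (free_group m)"
  let ?y = "rev (map flip x)"
  have "?y \<in> carrier (free_group m)"
    using x by (auto simp: free_group_def reduced_inverse)
  moreover have "foldr push ?y x = []"
    using x mult_inverse[of x] by (simp add: free_group_def mult_Nil)
  ultimately show "\<exists>y\<in>carrier (free_group m). y \<otimes>\<^bsub>free_group m\<^esub> x = \<one>\<^bsub>free_group m\<^esub>"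
    by (intro bexI[of _ ?y]) (auto simp: free_group_def)
next
  fix x y assume "x \<in> carrier (free_group m)" "y \<in> carrier (free_group m)"
  then show "x \<otimes>\<^bsub>free_group m\<^esub> y \<in> carrier (free_group m)"
    using set_mult[of x y] 
    by (simp add: free_group_def reduced_mult) (meson Un_least order_trans)
qed (auto simp: free_group_def mult_assoc)

lemma inv_free_group:
  assumes "w \<in> carrier (free_group m)"
  shows "inv\<^bsub>free_group m\<^esub> w = rev (map flip w)"
proof (rule group.inv_equality[OF group_free_group])
  show "rev (map flip w) \<otimes>\<^bsub>free_group m\<^esub> w = \<one>\<^bsub>free_group m\<^esub>"
    using assms mult_inverse[of w] by (simp add: free_group_def mult_Nil)
  show "rev (map flip w) \<in> carrier (free_group m)"
    using assms by (auto simp: free_group_def reduced_inverse)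
qed fact

definition hat :: "word \<Rightarrow> word" where
  "hat w = map flip w"

lemma hat_push: "hat (push x w) = push (flip x) (hat w)"
proof (cases w)
  case (Cons y ys)
  then show ?thesis by (cases "y = flip x") (auto simp: hat_def push_def simp flip: flip_eq_iff[of y])
qed (simp add: hat_def push_def)

lemma hat_mult: "hat (foldr push u v) = foldr push (hat u) (hat v)"
  by (induction u) (simp_all add: hat_push, simp_all add: hat_def)

lemma hat_hat: "hat (hat w) = w"
  by (simp add: hat_def comp_def)

lemma hat_carrier: "w \<in> carrier (free_group m) \<Longrightarrow> hat w \<in> carrier (free_group m)"
proof -
  have "reduced_word w \<Longrightarrow> reduced_word (map flip w)"
    unfolding reduced_word_def successively_map
    by (erule successively_mono) (auto simp: flip_def prod_eq_iff)
  then show "w \<in> carrier (free_group m) \<Longrightarrow> hat w \<in> carrier (free_group m)"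
    by (auto simp: free_group_def hat_def)
qed

lemma hat_iso: "hat \<in> iso (free_group m) (free_group m)"
proof (rule isoI)
  show "hat \<in> hom (free_group m) (free_group m)"
    by (rule homI) (simp_all add: hat_carrier, simp add: free_group_def hat_mult)
  show "bij_betw hat (carrier (free_group m)) (carrier (free_group m))"
    by (rule bij_betw_byWitness[where f' = hat]) (auto simp: hat_hat hat_carrier)
qed

lemma hat_gen: "1 \<le> i \<Longrightarrow> i \<le> m \<Longrightarrow> hat (gen i) = inv\<^bsub>free_group m\<^esub> (gen i)"
  by (subst inv_free_group) (auto simp: free_group_def gen_def reduced_Cons hat_def)

definition antisymmetric :: "nat \<Rightarrow> word pmf \<Rightarrow> bool" where
  "antisymmetric m \<mu> \<longleftrightarrow> (\<forall>g\<in>carrier (free_group m). pmf \<mu> g = pmf \<mu> (hat g))"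

definition cayley_edges :: "nat \<Rightarrow> (word \<times> word) set" where
  "cayley_edges m =
     {(g, h). g \<in> carrier (free_group m) \<and>
        (\<exists>i\<in>{1..m}. h = g \<otimes>\<^bsub>free_group m\<^esub> gen i \<or> 
                     h = g \<otimes>\<^bsub>free_group m\<^esub> inv\<^bsub>free_group m\<^esub> (gen i))}"

definition cayley_dist :: "nat \<Rightarrow> word \<Rightarrow> word \<Rightarrow> nat" where
  "cayley_dist m g h = (LEAST n. (g, h) \<in> cayley_edges m ^^ n)"

definition boundary :: "nat \<Rightarrow> (nat \<Rightarrow> word) set" where
  "boundary m =
     {\<xi>. \<xi> 0 = \<one>\<^bsub>free_group m\<^esub> \<and> (\<forall>i. \<xi> i \<in> carrier (free_group m)) \<and>
         (\<forall>i j. i \<le> j \<longrightarrow> cayley_dist m (\<xi> i) (\<xi> j) = j - i)}"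

definition cylinder :: "nat \<Rightarrow> word \<Rightarrow> (nat \<Rightarrow> word) set" where
  "cylinder m g = {\<xi> \<in> boundary m. g \<in> range \<xi>}"

(* The cylinders form a countable base of the topology of the boundary, so they generate
   its Borel sigma-algebra. *)

definition boundary_space :: "nat \<Rightarrow> (nat \<Rightarrow> word) measure" where
  "boundary_space m = sigma (boundary m) (cylinder m ` carrier (free_group m))"

(* Convergence in the end compactification of the tree: every vertex of the ray eventually
   lies on the geodesic from the identity to X k. *)

definition converges_to :: "nat \<Rightarrow> (nat \<Rightarrow> word) \<Rightarrow> (nat \<Rightarrow> word) \<Rightarrow> bool" where
  "converges_to m X \<xi> \<longleftrightarrow>
     (\<forall>n. \<forall>\<^sub>F k in sequentially.
        cayley_dist m \<one>\<^bsub>free_group m\<^esub> (X k) =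
        cayley_dist m \<one>\<^bsub>free_group m\<^esub> (\<xi> n) + cayley_dist m (\<xi> n) (X k))"

(* Sequences without a limit are sent to an arbitrarily chosen ray, so that the map is total with
   values in the boundary. *)

definition limit_point :: "nat \<Rightarrow> (nat \<Rightarrow> word) \<Rightarrow> (nat \<Rightarrow> word)" where
  "limit_point m X =
     (if \<exists>\<xi>\<in>boundary m. converges_to m X \<xi>
      then THE \<xi>. \<xi> \<in> boundary m \<and> converges_to m X \<xi>
      else (\<lambda>n. gen 1 [^]\<^bsub>free_group m\<^esub> n))"

definition steps :: "word pmf \<Rightarrow> (nat \<Rightarrow> word) measure" where
  "steps \<mu> = (\<Pi>\<^sub>M k\<in>UNIV. measure_pmf \<mu>)"

(* The k-th coordinate of s is the increment from time k to time k + 1. *)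

primrec walk :: "nat \<Rightarrow> word \<Rightarrow> (nat \<Rightarrow> word) \<Rightarrow> nat \<Rightarrow> word" where
  "walk m x s 0 = x"
| "walk m x s (Suc k) = walk m x s k \<otimes>\<^bsub>free_group m\<^esub> s k"

definition hitting_measure :: "nat \<Rightarrow> word pmf \<Rightarrow> (nat \<Rightarrow> word) measure" where
  "hitting_measure m \<mu> =
     distr (steps \<mu>) (boundary_space m) (\<lambda>s. limit_point m (walk m \<one>\<^bsub>free_group m\<^esub> s))"

(* The events are disjoint over k, so the series converges and its sum is at most 1. *)

definition first_passage :: "nat \<Rightarrow> word pmf \<Rightarrow> word \<Rightarrow> word \<Rightarrow> real" where
  "first_passage m \<mu> x y =
     (\<Sum>k. \<P>(s in steps \<mu>. walk m x s k = y \<and> (\<forall>j<k. walk m x s j \<noteq> y)))"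

(* The k-th roots lie in [0, 1], so passing from ereal to real loses nothing. *)

definition rho :: "nat \<Rightarrow> word pmf \<Rightarrow> word \<Rightarrow> real" where
  "rho m \<mu> g =
     real_of_ereal (liminf (\<lambda>k. 
       ereal (root k (first_passage m \<mu> \<one>\<^bsub>free_group m\<^esub> (g [^]\<^bsub>free_group m\<^esub> k)))))"

end

theory Submission
  imports Defs "HOL-Library.Sublist"
begin

text \<open>
  Write \<open>F(g)\<close> for the probability that the walk started at the identity ever visits \<open>g\<close>, and \<open>\<nu>(a)\<close>
  for the probability that its limit lies in the cone of words beginning with the letter \<open>a\<close>.

  Three facts carry the proof. First, left translation by \<open>a\<close> takes the words that do not begin with
  \<open>a\<inverse>\<close> to the words that begin with \<open>a\<close>; hence a walk started at \<open>a\<close> ends in the cone of \<open>a\<close> with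
  probability \<open>1 - \<nu>(a\<inverse>)\<close>. Second, antisymmetry gives \<open>\<nu>(a\<inverse>) = \<nu>(a)\<close>. By the strong Markov property
  at the first visit to \<open>a\<close>, the event that the walk visits \<open>a\<close> and then ends in the cone of \<open>a\<close>
  has probability \<open>F(a)(1 - \<nu>(a))\<close> (lemma \<open>prob_visit_and_cone_limit\<close>). Third, it matters whether the
  cone of \<open>a\<close> can be entered without a visit to \<open>a\<close>. For a letter of index at least two this is
  impossible, so the probability above is all of \<open>\<nu>(a)\<close> and \<open>F(a) = \<nu>(a)/(1 - \<nu>(a))\<close>. For \<open>a\<^sub>1\<close> the
  step \<open>a\<^sub>1a\<^sub>2\<close> jumps over \<open>a\<^sub>1\<close>, and from \<open>a\<^sub>1a\<^sub>2\<close> the walk fails to return to \<open>a\<^sub>1\<close> with probability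
  \<open>1 - F(a\<^sub>2\<inverse>) > 0\<close>; such a walk ends in the cone of \<open>a\<^sub>1\<close>, which makes the inequality strict
  (lemma \<open>cone_measure_gt_passage\<close>).

  The jump only leads into the cone of \<open>a\<^sub>1a\<^sub>2\<close>, whose only exit is \<open>a\<^sub>1\<close>, and this cone contains no power
  of \<open>a\<^sub>1\<close>. So every visit to a power of a letter is preceded by a visit to the letter itself, whence
  \<open>F(a\<^sup>n) = F(a)\<^sup>n\<close> and \<open>\<rho>(a) = F(a)\<close>. The last claim follows by rewriting the inequalities as
  \<open>1/(1 + F(a)\<inverse>) \<le> \<nu>(a)\<close>, strict for index one, because the cones of the letters are disjoint.

  For all this \<open>\<nu>\<close> has to be the law of an actual limit, so convergence of almost every path is proved
  as well. Pairing each step with its image under the involution, antisymmetry shows that the word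
  length grows on average by a fixed amount wherever the walk is. Therefore \<open>t\<close> to the power of the word
  length decays exponentially in mean for some \<open>t < 1\<close>, and by Borel--Cantelli the length tends to
  infinity. As a step changes only the last two letters of a word, every prefix eventually freezes.
\<close>

section \<open>Reduced words and the word metric\<close>

lemma carrier_free_group_iff:
  "w \<in> carrier (free_group m) \<longleftrightarrow> reduced_word w \<and> fst ` set w \<subseteq> {1..m}"
  by (simp add: free_group_def)

lemma mult_free_group [simp]: "u \<otimes>\<^bsub>free_group m\<^esub> v = foldr push u v"
  by (simp add: free_group_def)

lemma one_free_group [simp]: "\<one>\<^bsub>free_group m\<^esub> = []"
  by (simp add: free_group_def)

lemma mult_letter:
  assumes "reduced_word w"
  shows "foldr push w [x] = (if w \<noteq> [] \<and> last w = flip x then butlast w else w @ [x])"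
  using assms
proof (induction w)
  case (Cons y w)
  then show ?case
    by (cases w) (auto simp: push_def reduced_Cons split: list.splits)
qed simp

lemma push_reduced_Cons: "reduced_word (x # w) \<Longrightarrow> push x w = x # w"
  by (auto simp: push_def reduced_Cons split: list.splits)

lemma reduced_appendD:
  assumes "reduced_word (u @ v)"
  shows "reduced_word u" "reduced_word v"
  using assms by (auto simp: reduced_word_def successively_append_iff)

lemma mult_eq_append: "reduced_word (u @ v) \<Longrightarrow> foldr push u v = u @ v"
  by (induction u) (auto simp: push_reduced_Cons reduced_Cons)

lemma length_push: "length (push x w) \<le> Suc (length w)"
  by (auto simp: push_def split: list.splits)

lemma push_eq_Cons_if_length: "length (push x w) = Suc (length w) \<Longrightarrow> push x w = x # w"
  by (auto simp: push_def split: list.splits if_splits)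

lemma length_mult: "length (foldr push u v) \<le> length u + length v"
proof (induction u)
  case (Cons x u)
  then show ?case using length_push[of x "foldr push u v"] by simp
qed simp

lemma mult_eq_append_if_length:
  "length (foldr push u v) = length u + length v \<Longrightarrow> foldr push u v = u @ v"
proof (induction u)
  case (Cons x u)
  have "length (foldr push u v) = length u + length v"
    using Cons.prems length_push[of x "foldr push u v"] length_mult[of u v] by simp
  with Cons.IH have "foldr push u v = u @ v" by simp
  with Cons.prems show ?case
    by (auto simp: push_eq_Cons_if_length)
qed simp

definition letters :: "nat \<Rightarrow> letter set" where
  "letters m = {1..m} \<times> UNIV"

lemma letters_iff: "x \<in> letters m \<longleftrightarrow> fst x \<in> {1..m}"
  by (cases x) (simp add: letters_def)

lemma letter_in_carrier: "[x] \<in> carrier (free_group m) \<longleftrightarrow> x \<in> letters m"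
  by (auto simp: carrier_free_group_iff letters_iff reduced_Cons)

lemma inv_letter:
  "x \<in> letters m \<Longrightarrow> inv\<^bsub>free_group m\<^esub> [x] = [flip x]"
  by (subst inv_free_group) (auto simp: letter_in_carrier)

lemma cayley_edges_eq:
  "cayley_edges m = {(g, foldr push g [x]) | g x. g \<in> carrier (free_group m) \<and> x \<in> letters m}"
    (is "?L = ?R")
proof (intro equalityI subrelI)
  fix g h assume "(g, h) \<in> ?L"
  then obtain i where i: "g \<in> carrier (free_group m)" "i \<in> {1..m}"
    "h = foldr push g [(i, True)] \<or> h = foldr push g (inv\<^bsub>free_group m\<^esub> [(i, True)])"
    by (auto simp: cayley_edges_def gen_def)
  then show "(g, h) \<in> ?R" 
    using inv_letter[of "(i, True)" m] letters_iff[of "flip (i, True)" m] 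
    by (auto simp: letters_iff simp del: split_paired_Ex)
next
  fix g h assume "(g, h) \<in> ?R"
  then obtain i b where i: "g \<in> carrier (free_group m)" "i \<in> {1..m}" "h = foldr push g [(i, b)]"
    by (auto simp: letters_def)
  then have "h = g \<otimes>\<^bsub>free_group m\<^esub> gen i \<or> 
      h = g \<otimes>\<^bsub>free_group m\<^esub> inv\<^bsub>free_group m\<^esub> (gen i)"
    using inv_letter[of "(i, True)" m] by (cases b) (auto simp: letters_iff gen_def flip_def)
  with i show "(g, h) \<in> ?L"
    unfolding cayley_edges_def by blast
qed

lemma relpow_cayley_edges_carrier:
  "(g, h) \<in> cayley_edges m ^^ n \<Longrightarrow> g \<in> carrier (free_group m) \<Longrightarrow> h \<in> carrier (free_group m)"
proof (induction n arbitrary: h)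
  case (Suc n)
  then obtain k where k: "(g, k) \<in> cayley_edges m ^^ n" "(k, h) \<in> cayley_edges m" by auto
  interpret group "free_group m" by (rule group_free_group)
  from k(2) obtain x where "x \<in> letters m" "h = k \<otimes>\<^bsub>free_group m\<^esub> [x]"
    by (auto simp: cayley_edges_eq)
  with Suc k(1) show ?case by (metis m_closed letter_in_carrier)
qed simp

text \<open>Reading the letters of \<open>w\<close> one after the other gives a path; together with
  \<open>relpow_cayley_edges_length\<close>, which says that no path is shorter, this determines the word metric.\<close>
lemma relpow_cayley_edges_append:
  "g \<in> carrier (free_group m) \<Longrightarrow> w \<in> carrier (free_group m) \<Longrightarrow>
     (g, g \<otimes>\<^bsub>free_group m\<^esub> w) \<in> cayley_edges m ^^ length w"
proof (induction w rule: rev_induct)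
  case Nil
  then show ?case by (simp add: carrier_free_group_iff mult_Nil)
next
  case (snoc x w)
  interpret group "free_group m" by (rule group_free_group)
  have w: "w \<in> carrier (free_group m)" "x \<in> letters m"
    using snoc.prems(2) reduced_appendD[of w "[x]"] 
    by (auto simp: carrier_free_group_iff letters_iff)
  have "w @ [x] = w \<otimes>\<^bsub>free_group m\<^esub> [x]"
    using snoc.prems(2) by (simp add: carrier_free_group_iff mult_eq_append del: foldr.simps)
  then have "g \<otimes>\<^bsub>free_group m\<^esub> (w @ [x]) = (g \<otimes>\<^bsub>free_group m\<^esub> w) \<otimes>\<^bsub>free_group m\<^esub> [x]"
    using snoc.prems w by (metis m_assoc letter_in_carrier)
  moreover have "g \<otimes>\<^bsub>free_group m\<^esub> w \<in> carrier (free_group m)"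
    using snoc.prems w by (metis m_closed)
  ultimately have "(g \<otimes>\<^bsub>free_group m\<^esub> w, g \<otimes>\<^bsub>free_group m\<^esub> (w @ [x])) \<in> cayley_edges m"
    using w(2) unfolding cayley_edges_eq mult_free_group by blast
  then show ?case using snoc.IH[OF snoc.prems(1) w(1)] by (simp del: mult_free_group) blast
qed

lemma relpow_cayley_edges_length:
  assumes "g \<in> carrier (free_group m)"
  shows "(g, h) \<in> cayley_edges m ^^ n \<Longrightarrow>
           length (inv\<^bsub>free_group m\<^esub> g \<otimes>\<^bsub>free_group m\<^esub> h) \<le> n"
proof (induction n arbitrary: h)
  case 0
  interpret group "free_group m" by (rule group_free_group)
  show ?case using 0 l_inv[OF assms] by simp
next
  case (Suc n)
  interpret group "free_group m" by (rule group_free_group)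
  from Suc.prems obtain k where k: "(g, k) \<in> cayley_edges m ^^ n" "(k, h) \<in> cayley_edges m" by auto
  from k(2) obtain x where x: "x \<in> letters m" "h = k \<otimes>\<^bsub>free_group m\<^esub> [x]"
    by (auto simp: cayley_edges_eq)
  have "k \<in> carrier (free_group m)" using relpow_cayley_edges_carrier[OF k(1) assms] .
  then have "inv\<^bsub>free_group m\<^esub> g \<otimes>\<^bsub>free_group m\<^esub> h = 
     (inv\<^bsub>free_group m\<^esub> g \<otimes>\<^bsub>free_group m\<^esub> k) \<otimes>\<^bsub>free_group m\<^esub> [x]"
    using x assms by (metis m_assoc letter_in_carrier inv_closed)
  with Suc.IH[OF k(1)] length_mult[of "inv\<^bsub>free_group m\<^esub> g \<otimes>\<^bsub>free_group m\<^esub> k" "[x]"]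
  show ?case by simp
qed

lemma cayley_dist_eq:
  assumes "g \<in> carrier (free_group m)" "h \<in> carrier (free_group m)"
  shows "cayley_dist m g h = length (inv\<^bsub>free_group m\<^esub> g \<otimes>\<^bsub>free_group m\<^esub> h)"
proof -
  interpret group "free_group m" by (rule group_free_group)
  let ?w = "inv\<^bsub>free_group m\<^esub> g \<otimes>\<^bsub>free_group m\<^esub> h"
  have "?w \<in> carrier (free_group m)" using assms by (metis m_closed inv_closed)
  moreover have "g \<otimes>\<^bsub>free_group m\<^esub> ?w = h"
    using assms by (metis m_assoc r_inv inv_closed l_one)
  ultimately have "(g, h) \<in> cayley_edges m ^^ length ?w"
    using relpow_cayley_edges_append[OF assms(1)] by metis
  then show ?thesis
    unfolding cayley_dist_def
    by (rule Least_equality) (rule relpow_cayley_edges_length[OF assms(1)])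
qed

lemma cayley_dist_one:
  assumes "h \<in> carrier (free_group m)"
  shows "cayley_dist m [] h = length h"
proof -
  have "[] \<in> carrier (free_group m)" by (simp add: carrier_free_group_iff)
  from cayley_dist_eq[OF this assms] inv_free_group[OF this] show ?thesis by simp
qed

text \<open>No edge leaves the group, so the minimum in the definition of the distance ranges over the empty
  set. What matters is that the resulting value is the same for all \<open>g\<close>: then a point outside the
  group can satisfy the equation in the definition of convergence only for a vertex at distance zero.\<close>
lemma cayley_dist_outside:
  assumes "g \<in> carrier (free_group m)" "h \<notin> carrier (free_group m)"
  shows "cayley_dist m g h = (LEAST n. False)"
proof -
  have "(g, h) \<notin> cayley_edges m ^^ n" for n
    using relpow_cayley_edges_carrier[of g h n m] assms by blast
  then show ?thesis by (simp add: cayley_dist_def)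
qed

text \<open>The tree structure of the Cayley graph: \<open>g\<close> lies between the identity and \<open>h\<close> exactly if no
  cancellation takes place in \<open>g (g\<inverse>h)\<close>, that is, if \<open>h\<close> extends \<open>g\<close> as a word.\<close>
lemma on_geodesic_iff_prefix:
  assumes "g \<in> carrier (free_group m)" "h \<in> carrier (free_group m)"
  shows "length h = length g + cayley_dist m g h \<longleftrightarrow> prefix g h"
proof
  interpret group "free_group m" by (rule group_free_group)
  let ?w = "inv\<^bsub>free_group m\<^esub> g \<otimes>\<^bsub>free_group m\<^esub> h"
  have h: "h = foldr push g ?w"
    using assms by (metis m_assoc r_inv inv_closed l_one mult_free_group)
  assume "length h = length g + cayley_dist m g h"
  then have "length (foldr push g ?w) = length g + length ?w"
    using h by (metis cayley_dist_eq assms)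
  then have "h = g @ ?w"
    using mult_eq_append_if_length h by metis
  then show "prefix g h" by (metis prefixI)
next
  interpret group "free_group m" by (rule group_free_group)
  assume "prefix g h"
  then obtain w where w: "h = g @ w" by (elim prefixE)
  have "w \<in> carrier (free_group m)"
    using assms(2) reduced_appendD[of g w] by (auto simp: w carrier_free_group_iff)
  moreover have "h = g \<otimes>\<^bsub>free_group m\<^esub> w"
    using mult_eq_append[of g w] assms(2) by (simp add: w carrier_free_group_iff)
  ultimately have "inv\<^bsub>free_group m\<^esub> g \<otimes>\<^bsub>free_group m\<^esub> h = w"
    using assms(1) by (metis m_assoc l_inv inv_closed l_one)
  then show "length h = length g + cayley_dist m g h"
    using cayley_dist_eq[OF assms] w by (metis length_append)
qed

section \<open>Rays and limit points\<close>

lemma prefix_antisym_length: "prefix g w \<Longrightarrow> prefix h w \<Longrightarrow> length g = length h \<Longrightarrow> g = h"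
  by (metis append_eq_append_conv prefix_def)

lemma boundary_iff:
  "\<xi> \<in> boundary m \<longleftrightarrow>
     (\<forall>i. \<xi> i \<in> carrier (free_group m) \<and> length (\<xi> i) = i) \<and> (\<forall>i j. i \<le> j \<longrightarrow> prefix (\<xi> i) (\<xi> j))"
    (is "_ \<longleftrightarrow> ?c \<and> ?p")
proof
  assume \<xi>: "\<xi> \<in> boundary m"
  then have car: "\<xi> i \<in> carrier (free_group m)" for i by (simp add: boundary_def)
  have dist: "i \<le> j \<Longrightarrow> cayley_dist m (\<xi> i) (\<xi> j) = j - i" for i j
    using \<xi> by (simp add: boundary_def)
  have "\<xi> 0 = []" using \<xi> by (simp add: boundary_def)
  then have len: "length (\<xi> i) = i" for i
    using dist[of 0 i] cayley_dist_one[OF car] by simp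
  have "prefix (\<xi> i) (\<xi> j)" if "i \<le> j" for i j
    using on_geodesic_iff_prefix[OF car car, of j i] dist[OF that] that by (simp add: len)
  with car len show "?c \<and> ?p" by blast
next
  assume cp: "?c \<and> ?p"
  have "cayley_dist m (\<xi> i) (\<xi> j) = j - i" if "i \<le> j" for i j
    using on_geodesic_iff_prefix[of "\<xi> i" m "\<xi> j"] cp that by simp
  moreover have "\<xi> 0 = []" using cp by (metis length_0_conv)
  ultimately show "\<xi> \<in> boundary m"
    using cp by (simp add: boundary_def)
qed

lemma converges_to_iff:
  assumes "\<xi> \<in> boundary m"
  shows "converges_to m X \<xi> \<longleftrightarrow>
    (\<forall>n. \<forall>\<^sub>F k in sequentially. X k \<in> carrier (free_group m) \<and> prefix (\<xi> n) (X k))"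
proof -
  have \<xi>: "\<xi> n \<in> carrier (free_group m)" "length (\<xi> n) = n" for n
    using assms by (auto simp: boundary_iff)
  have "[] \<in> carrier (free_group m)" by (simp add: carrier_free_group_iff)
  then have *: "cayley_dist m [] (X k) = cayley_dist m [] (\<xi> n) + cayley_dist m (\<xi> n) (X k) \<longleftrightarrow>
      X k \<in> carrier (free_group m) \<and> prefix (\<xi> n) (X k)" if "n > 0" for n k
    using that cayley_dist_outside[of _ m "X k"] on_geodesic_iff_prefix[of "\<xi> n" m "X k"] \<xi>[of n]
    by (cases "X k \<in> carrier (free_group m)") (auto simp: cayley_dist_one)
  have 0: "\<xi> 0 = []" using \<xi>(2)[of 0] by simp
  have drop_0: "(\<forall>n. P n) \<longleftrightarrow> (\<forall>n>0. P n)" if "P 0" for P :: "nat \<Rightarrow> bool"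
    using that by (metis gr0I)
  have "cayley_dist m [] (X k) = cayley_dist m [] (\<xi> 0) + cayley_dist m (\<xi> 0) (X k)" for k
    using cayley_dist_one[of "[]" m] by (simp add: 0 carrier_free_group_iff)
  then have "converges_to m X \<xi> \<longleftrightarrow> (\<forall>n>0. \<forall>\<^sub>F k in sequentially. 
     cayley_dist m [] (X k) = cayley_dist m [] (\<xi> n) + cayley_dist m (\<xi> n) (X k))"
    unfolding converges_to_def one_free_group by (intro drop_0) simp
  also have "\<dots> \<longleftrightarrow> (\<forall>n>0. \<forall>\<^sub>F k in sequentially. X k \<in> carrier (free_group m) \<and> prefix (\<xi> n) (X k))"
    by (simp add: *)
  also have "\<dots> \<longleftrightarrow> (\<forall>n. \<forall>\<^sub>F k in sequentially. X k \<in> carrier (free_group m) \<and> prefix (\<xi> n) (X k))"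
  proof
    assume *: "\<forall>n>0. \<forall>\<^sub>F k in sequentially. X k \<in> carrier (free_group m) \<and> prefix (\<xi> n) (X k)"
    then have "\<forall>\<^sub>F k in sequentially. X k \<in> carrier (free_group m) \<and> prefix (\<xi> 1) (X k)" by simp
    then have "\<forall>\<^sub>F k in sequentially. X k \<in> carrier (free_group m) \<and> prefix (\<xi> 0) (X k)"
      by (rule eventually_mono) (simp add: 0)
    then have "\<forall>\<^sub>F k in sequentially. X k \<in> carrier (free_group m) \<and> prefix (\<xi> n) (X k)" for n
      using * by (cases "n = 0") auto
    then show "\<forall>n. \<forall>\<^sub>F k in sequentially. X k \<in> carrier (free_group m) \<and> prefix (\<xi> n) (X k)" ..
  qed blast
  finally show ?thesis .
qed

text \<open>Convergence to some ray, phrased without quantifying over the uncountably many rays: the ray is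
  assembled from the prefixes that are eventually constant. This form is visibly measurable.\<close>
definition stabilizes :: "nat \<Rightarrow> (nat \<Rightarrow> word) \<Rightarrow> bool" where
  "stabilizes m X \<longleftrightarrow>
     (\<forall>n. \<exists>g. length g = n \<and> (\<forall>\<^sub>F k in sequentially. X k \<in> carrier (free_group m) \<and> prefix g (X k)))"

lemma stabilizes_iff: "stabilizes m X \<longleftrightarrow> (\<exists>\<xi>\<in>boundary m. converges_to m X \<xi>)"
proof
  assume "stabilizes m X"
  define \<xi> where "\<xi> n = (SOME g. length g = n \<and>
      (\<forall>\<^sub>F k in sequentially. X k \<in> carrier (free_group m) \<and> prefix g (X k)))" for n
  have "length (\<xi> n) = n \<and>
      (\<forall>\<^sub>F k in sequentially. X k \<in> carrier (free_group m) \<and> prefix (\<xi> n) (X k))" for n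
    using \<open>stabilizes m X\<close> unfolding \<xi>_def stabilizes_def by (rule allE) (rule someI_ex)
  then have \<xi>: "\<And>n. length (\<xi> n) = n"
    "\<And>n. \<forall>\<^sub>F k in sequentially. X k \<in> carrier (free_group m) \<and> prefix (\<xi> n) (X k)"
    by simp_all
  have "\<xi> i \<in> carrier (free_group m) \<and> (i \<le> j \<longrightarrow> prefix (\<xi> i) (\<xi> j))" for i j
  proof -
    have "\<forall>\<^sub>F k in sequentially. X k \<in> carrier (free_group m) \<and> prefix (\<xi> i) (X k) \<and> prefix (\<xi> j) (X k)"
      using \<xi>(2)[of i] \<xi>(2)[of j] by eventually_elim simp
    from eventually_happens'[OF sequentially_bot this]
    obtain k where k: "X k \<in> carrier (free_group m)" "prefix (\<xi> i) (X k)" "prefix (\<xi> j) (X k)" by auto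
    then have "\<xi> i \<in> carrier (free_group m)"
      by (elim prefixE) (auto simp: carrier_free_group_iff dest: reduced_appendD)
    with k \<xi>(1) show ?thesis by (metis prefix_length_prefix)
  qed
  then have "\<xi> \<in> boundary m" using \<xi>(1) by (auto simp: boundary_iff)
  with \<xi>(2) show "\<exists>\<xi>\<in>boundary m. converges_to m X \<xi>" by (auto simp: converges_to_iff)
next
  assume "\<exists>\<xi>\<in>boundary m. converges_to m X \<xi>"
  then obtain \<xi> where \<xi>: "\<xi> \<in> boundary m" "converges_to m X \<xi>" by auto
  have "length (\<xi> n) = n" for n using \<xi>(1) by (simp add: boundary_iff)
  moreover have "\<forall>\<^sub>F k in sequentially. X k \<in> carrier (free_group m) \<and> prefix (\<xi> n) (X k)" for n
    using converges_to_iff[OF \<xi>(1), of X] \<xi>(2) by simp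
  ultimately show "stabilizes m X"
    unfolding stabilizes_def by (intro allI exI conjI)
qed

lemma eventually_prefix_unique:
  assumes "\<forall>\<^sub>F k in sequentially. prefix g (X k)" "\<forall>\<^sub>F k in sequentially. prefix h (X k)"
    and "length g = length h"
  shows "g = h"
proof -
  have "\<forall>\<^sub>F k in sequentially. prefix g (X k) \<and> prefix h (X k)"
    using assms(1,2) by eventually_elim simp
  from eventually_happens'[OF sequentially_bot this]
  obtain k where "prefix g (X k)" "prefix h (X k)" by auto
  then show ?thesis using prefix_antisym_length[of g "X k" h] assms(3) by simp
qed

lemma limit_point_eqI:
  assumes "\<xi> \<in> boundary m" "converges_to m X \<xi>"
  shows "limit_point m X = \<xi>"
proof -
  have unique: "\<eta> = \<xi>" if "\<eta> \<in> boundary m" "converges_to m X \<eta>" for \<eta>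
  proof
    fix n
    have "\<forall>\<^sub>F k in sequentially. prefix (\<eta> n) (X k)" "\<forall>\<^sub>F k in sequentially. prefix (\<xi> n) (X k)"
      using that assms by (auto simp: converges_to_iff eventually_conj_iff)
    moreover have "length (\<eta> n) = length (\<xi> n)"
      using that assms by (auto simp: boundary_iff)
    ultimately show "\<eta> n = \<xi> n" by (rule eventually_prefix_unique)
  qed
  have "(THE \<xi>. \<xi> \<in> boundary m \<and> converges_to m X \<xi>) = \<xi>"
    by (rule the_equality) (simp_all add: assms unique)
  moreover have "\<exists>\<xi>\<in>boundary m. converges_to m X \<xi>" using assms by blast
  ultimately show ?thesis by (simp add: limit_point_def)
qed

lemma limit_point_in_cylinder_iff:
  assumes "stabilizes m X"
  shows "limit_point m X \<in> cylinder m g \<longleftrightarrow> (\<forall>\<^sub>F k in sequentially. prefix g (X k))"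
proof -
  from assms obtain \<xi> where \<xi>: "\<xi> \<in> boundary m" "converges_to m X \<xi>"
    by (auto simp: stabilizes_iff)
  have pre: "\<forall>\<^sub>F k in sequentially. prefix (\<xi> n) (X k)" for n
    using \<xi> by (auto simp: converges_to_iff eventually_conj_iff)
  have len: "length (\<xi> n) = n" for n using \<xi> by (simp add: boundary_iff)
  have "g \<in> range \<xi> \<longleftrightarrow> (\<forall>\<^sub>F k in sequentially. prefix g (X k))"
  proof
    assume "\<forall>\<^sub>F k in sequentially. prefix g (X k)"
    then have "g = \<xi> (length g)"
      using eventually_prefix_unique[OF _ pre[of "length g"]] by (simp add: len)
    then show "g \<in> range \<xi>" by (metis rangeI)
  qed (use pre in auto)
  then show ?thesis
    using \<xi> limit_point_eqI[OF \<xi>] by (simp add: cylinder_def)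
qed

lemma reduced_replicate: "reduced_word (replicate n x)"
  by (induction n) (auto simp: reduced_Cons)

lemma pow_letter:
  "[x] [^]\<^bsub>free_group m\<^esub> n = replicate n x"
proof (induction n)
  case (Suc n)
  have "last (replicate n x) = x" if "replicate n x \<noteq> []" using that by simp
  then have "foldr push (replicate n x) [x] = replicate n x @ [x]"
    using mult_letter[OF reduced_replicate, of n x x] by (metis flip_neq(2))
  with Suc show ?case 
    by (simp add: nat_pow_def free_group_def replicate_append_same)
qed (simp add: nat_pow_def free_group_def)

lemma limit_point_in_boundary:
  assumes "m \<ge> 1"
  shows "limit_point m X \<in> boundary m"
proof (cases "stabilizes m X")
  case True
  then show ?thesis by (metis stabilizes_iff limit_point_eqI)
next
  case False
  have x: "(1, True) \<in> letters m" using assms by (simp add: letters_iff)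
  then have pow: "gen 1 [^]\<^bsub>free_group m\<^esub> n = replicate n (1, True)" for n
    by (simp add: gen_def pow_letter)
  have "replicate n (1, True) \<in> carrier (free_group m)" for n
    using x reduced_replicate by (auto simp: carrier_free_group_iff letters_iff)
  moreover have "prefix (replicate i x) (replicate j x)" if "i \<le> j" for i j and x :: letter
    using replicate_add[of i "j - i" x] that by (simp add: prefix_def)
  ultimately have "(\<lambda>n. gen 1 [^]\<^bsub>free_group m\<^esub> n) \<in> boundary m"
    unfolding boundary_iff pow by simp
  with False show ?thesis by (simp add: limit_point_def stabilizes_iff)
qed

section \<open>Independent steps and the strong Markov property\<close>

lemma prob_space_steps: "prob_space (steps \<mu>)"
  unfolding steps_def by (intro prob_space_PiM measure_pmf.prob_space_axioms)

lemma space_steps [simp]: "space (steps \<mu>) = UNIV"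
  by (simp add: steps_def space_PiM)

lemma measurable_step: "(\<lambda>s. s k) \<in> measurable (steps \<mu>) (count_space UNIV)"
proof -
  have "(\<lambda>s. s k) \<in> measurable (steps \<mu>) (measure_pmf \<mu>)"
    unfolding steps_def by (rule measurable_component_singleton) simp
  then show ?thesis by (simp cong: measurable_cong_sets)
qed

lemma Collect_in_sets_steps: "Measurable.pred (steps \<mu>) P \<Longrightarrow> {s. P s} \<in> sets (steps \<mu>)"
  by (simp add: pred_def)

lemma measurable_into_steps:
  assumes "\<And>n. (\<lambda>x. f x n) \<in> measurable M (count_space UNIV)"
  shows "f \<in> measurable M (steps \<mu>)"
  unfolding steps_def
  by (rule measurable_PiM_single') (use assms in \<open>auto simp: space_PiM cong: measurable_cong_sets\<close>)

lemma measurable_shift [measurable]: "(\<lambda>s n. s (k + n)) \<in> measurable (steps \<mu>) (steps \<nu>)"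
proof (rule measurable_into_steps)
  fix n show "(\<lambda>s. s (k + n)) \<in> measurable (steps \<mu>) (count_space UNIV)"
    by (rule measurable_step)
qed

lemma measurable_walk [measurable]:
  "(\<lambda>s. walk m x s k) \<in> measurable (steps \<mu>) (count_space UNIV)"
proof (induction k)
  case (Suc k)
  have "(\<lambda>s. foldr push u (s k)) \<in> measurable (steps \<mu>) (count_space UNIV)" for u
    by (rule measurable_compose[OF measurable_step]) simp
  then have "(\<lambda>s. foldr push (walk m x s k) (s k)) \<in> measurable (steps \<mu>) (count_space UNIV)"
    using Suc by (rule measurable_compose_countable[where f = "\<lambda>u s. foldr push u (s k)"])
  then show ?case by (simp only: walk.simps mult_free_group)
qed simp

lemma pred_walk: "Measurable.pred (steps \<mu>) (\<lambda>s. P (walk m x s k))"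
  by (rule measurable_compose[OF measurable_walk]) simp

lemma pred_walk_eq [measurable]: "Measurable.pred (steps \<mu>) (\<lambda>s. walk m x s k = y)"
  by (rule pred_walk)

lemma pred_walk_in [measurable]: "Measurable.pred (steps \<mu>) (\<lambda>s. walk m x s k \<in> A)"
  by (rule pred_walk)

lemma pred_prefix_walk [measurable]: "Measurable.pred (steps \<mu>) (\<lambda>s. prefix g (walk m x s k))"
  by (rule pred_walk)

lemma walk_cong: "(\<And>j. j < k \<Longrightarrow> s j = s' j) \<Longrightarrow> walk m x s k = walk m x s' k"
  by (induction k) auto

lemma walk_shift: "walk m x s (k + n) = walk m (walk m x s k) (\<lambda>i. s (k + i)) n"
  by (induction n) auto

lemma measurable_map_steps:
  "(\<lambda>s n. f (s n)) \<in> measurable (steps \<mu>) (steps \<nu>)"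
proof (rule measurable_into_steps)
  fix n show "(\<lambda>s. f (s n)) \<in> measurable (steps \<mu>) (count_space UNIV)"
    by (rule measurable_compose[OF measurable_step]) simp
qed

text \<open>The coordinates stay independent when the same map is applied to each of them, so it suffices to
  compare the two measures on finite-dimensional boxes.\<close>
lemma distr_steps_map:
  "distr (steps \<mu>) (steps (map_pmf f \<mu>)) (\<lambda>s n. f (s n)) = steps (map_pmf f \<mu>)"
    (is "distr _ _ ?f = _")
proof -
  interpret A: product_prob_space "\<lambda>_. measure_pmf \<mu>" "UNIV :: nat set"
    by unfold_locales
  interpret B: product_prob_space "\<lambda>_. measure_pmf (map_pmf f \<mu>)" "UNIV :: nat set"
    by unfold_locales
  have "distr (steps \<mu>) (steps (map_pmf f \<mu>)) ?f = PiM UNIV (\<lambda>_. measure_pmf (map_pmf f \<mu>))"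
  proof (rule B.PiM_eq)
    fix J :: "nat set" and E :: "nat \<Rightarrow> word set" assume J: "finite J" "J \<subseteq> UNIV"
    let ?X = "\<lambda>\<nu> E. prod_emb UNIV (\<lambda>_. measure_pmf \<nu>) J (\<Pi>\<^sub>E j\<in>J. E j)"
    have X: "?X \<nu> E = {s. \<forall>j\<in>J. s j \<in> E j}" for \<nu> :: "word pmf" and E
      by (auto simp: prod_emb_def PiE_iff)
    have "?X (map_pmf f \<mu>) E \<in> sets (steps (map_pmf f \<mu>))"
      unfolding steps_def using J by (intro sets_PiM_I) auto
    then have "emeasure (distr (steps \<mu>) (steps (map_pmf f \<mu>)) ?f) (?X (map_pmf f \<mu>) E)
        = emeasure (steps \<mu>) (?X \<mu> (\<lambda>j. f -` E j))"
      by (subst emeasure_distr) (auto simp: X measurable_map_steps intro!: arg_cong[of _ _ "emeasure _"])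
    also have "\<dots> = (\<Prod>j\<in>J. emeasure (measure_pmf \<mu>) (f -` E j))"
      unfolding steps_def using J by (intro A.emeasure_PiM_emb) auto
    finally show "emeasure (distr (steps \<mu>) (steps (map_pmf f \<mu>)) ?f) (?X (map_pmf f \<mu>) E)
        = (\<Prod>j\<in>J. emeasure (measure_pmf (map_pmf f \<mu>)) (E j))"
      by simp
  qed (simp add: steps_def)
  then show ?thesis by (simp add: steps_def)
qed

lemma prob_steps_map:
  assumes "map_pmf f \<mu> = \<mu>" and [measurable]: "Measurable.pred (steps \<mu>) P"
  shows "\<P>(s in steps \<mu>. P (\<lambda>n. f (s n))) = \<P>(s in steps \<mu>. P s)"
proof -
  have "\<P>(s in steps \<mu>. P s) = \<P>(s in distr (steps \<mu>) (steps \<mu>) (\<lambda>s n. f (s n)). P s)"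
    using distr_steps_map[of \<mu> f] assms(1) by simp
  also have "\<dots> = measure (steps \<mu>) ((\<lambda>s n. f (s n)) -` {s. P s} \<inter> space (steps \<mu>))"
    by (subst measure_distr) (auto simp: Collect_in_sets_steps[OF assms(2)] measurable_map_steps)
  finally show ?thesis by simp
qed

lemma AE_steps_in_support: "AE s in steps \<mu>. \<forall>k. s k \<in> set_pmf \<mu>"
proof -
  have "AE s in steps \<mu>. s k \<in> set_pmf \<mu>" for k
    unfolding steps_def
    by (rule AE_PiM_component) (auto intro: measure_pmf.prob_space_axioms AE_pmfI)
  then show ?thesis by (simp add: AE_all_countable)
qed

text \<open>Past and future are independent: splicing the first \<open>k\<close> steps of one sequence with an independent
  second sequence has the law of a single sequence, and the two events then concern different
  factors.\<close>
lemma markov: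
  assumes [measurable]: "Measurable.pred (steps \<mu>) A" "Measurable.pred (steps \<mu>) B"
    and past: "\<And>s s'. (\<And>j. j < k \<Longrightarrow> s j = s' j) \<Longrightarrow> A s = A s'"
  shows "\<P>(s in steps \<mu>. A s \<and> B (\<lambda>n. s (k + n))) = \<P>(s in steps \<mu>. A s) * \<P>(s in steps \<mu>. B s)"
proof -
  interpret prob_space "steps \<mu>" by (rule prob_space_steps)
  interpret seq: sequence_space "measure_pmf \<mu>" by unfold_locales
  have comb [measurable]: "(\<lambda>(s, t). comb_seq k s t) \<in> measurable (steps \<mu> \<Otimes>\<^sub>M steps \<mu>) (steps \<mu>)"
    unfolding steps_def by (rule measurable_comb_seq)
  have "A (comb_seq k s t) = A s" for s t by (rule past) (simp add: comb_seq_less)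
  moreover have "(\<lambda>n. comb_seq k s t (k + n)) = t" for s t :: "nat \<Rightarrow> word"
    by (simp add: comb_seq_def)
  ultimately have vim: "(\<lambda>(s, t). comb_seq k s t) -` {s. A s \<and> B (\<lambda>n. s (k + n))} \<inter> 
       space (steps \<mu> \<Otimes>\<^sub>M steps \<mu>) = {s. A s} \<times> {s. B s}"
    by (auto simp: space_pair_measure)
  have A: "{s. A s} \<in> sets (steps \<mu>)" "{s. B s} \<in> sets (steps \<mu>)"
    using assms(1,2) by (simp_all add: Collect_in_sets_steps)
  have "{s \<in> space (steps \<mu>). A s \<and> B (\<lambda>n. s (k + n))} \<in> sets (steps \<mu>)" by measurable
  then have E: "{s. A s \<and> B (\<lambda>n. s (k + n))} \<in> sets (steps \<mu>)" by simp
  have "\<P>(s in steps \<mu>. A s \<and> B (\<lambda>n. s (k + n))) = 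
      measure (distr (steps \<mu> \<Otimes>\<^sub>M steps \<mu>) (steps \<mu>) (\<lambda>(s, t). comb_seq k s t))
        {s. A s \<and> B (\<lambda>n. s (k + n))}"
    using seq.PiM_comb_seq[of k] by (simp add: steps_def[symmetric])
  also have "\<dots> = measure (steps \<mu> \<Otimes>\<^sub>M steps \<mu>) ({s. A s} \<times> {s. B s})"
    using vim by (subst measure_distr[OF comb E]) simp
  also have "\<dots> = measure (steps \<mu>) {s. A s} * measure (steps \<mu>) {s. B s}"
    using emeasure_pair_measure_Times[OF A] by (simp add: measure_def enn2real_mult)
  finally show ?thesis by simp
qed

lemma first_visit_sums:
  assumes [measurable]: "Measurable.pred (steps \<mu>) E"
  shows "(\<lambda>k. \<P>(s in steps \<mu>. (walk m x s k = y \<and> (\<forall>j<k. walk m x s j \<noteq> y)) \<and> E s)) sums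
           \<P>(s in steps \<mu>. (\<exists>k. walk m x s k = y) \<and> E s)"
proof -
  interpret prob_space "steps \<mu>" by (rule prob_space_steps)
  let ?A = "\<lambda>k. {s. (walk m x s k = y \<and> (\<forall>j<k. walk m x s j \<noteq> y)) \<and> E s}"
  have "{s \<in> space (steps \<mu>). (walk m x s k = y \<and> (\<forall>j<k. walk m x s j \<noteq> y)) \<and> E s} \<in> sets (steps \<mu>)" for k
    by measurable
  then have "range ?A \<subseteq> sets (steps \<mu>)" by auto
  moreover have "disjoint_family ?A"
    by (auto simp: disjoint_family_on_def) (metis nat_neq_iff)
  moreover have "(\<Union>k. ?A k) = {s. (\<exists>k. walk m x s k = y) \<and> E s}"
  proof (intro equalityI subsetI)
    fix s assume s: "s \<in> {s. (\<exists>k. walk m x s k = y) \<and> E s}"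
    then obtain k where "walk m x s k = y" "\<forall>j<k. walk m x s j \<noteq> y"
      using exists_least_iff[of "\<lambda>k. walk m x s k = y"] by auto
    with s show "s \<in> (\<Union>k. ?A k)" by auto
  qed auto
  ultimately show ?thesis using finite_measure_UNION[of ?A] by simp
qed

lemma first_passage_eq_prob_hit:
  "first_passage m \<mu> x y = \<P>(s in steps \<mu>. \<exists>k. walk m x s k = y)"
  using sums_unique[OF first_visit_sums[of "\<lambda>_. True" \<mu> m x y]] by (simp add: first_passage_def)

text \<open>The first visit to \<open>y\<close> happens at a definite time \<open>k\<close>, so the Markov property at each \<open>k\<close> can be summed.
  The event \<open>E\<close> needs to be expressible through the future after the first visit only along paths
  whose steps lie in the support.\<close>
lemma strong_markov:
  assumes [measurable]: "Measurable.pred (steps \<mu>) E" "Measurable.pred (steps \<mu>) E'"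
    and restart: "\<And>s k. (\<And>i. s i \<in> set_pmf \<mu>) \<Longrightarrow> walk m x s k = y \<Longrightarrow> (\<And>j. j < k \<Longrightarrow> walk m x s j \<noteq> y) \<Longrightarrow>
                    E s \<longleftrightarrow> E' (\<lambda>n. s (k + n))"
  shows "\<P>(s in steps \<mu>. (\<exists>k. walk m x s k = y) \<and> E s) = 
           first_passage m \<mu> x y * \<P>(s in steps \<mu>. E' s)"
proof -
  interpret prob_space "steps \<mu>" by (rule prob_space_steps)
  have "\<P>(s in steps \<mu>. (walk m x s k = y \<and> (\<forall>j<k. walk m x s j \<noteq> y)) \<and> E s) =
      \<P>(s in steps \<mu>. walk m x s k = y \<and> (\<forall>j<k. walk m x s j \<noteq> y)) * \<P>(s in steps \<mu>. E' s)" for k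
  proof -
    have "\<P>(s in steps \<mu>. (walk m x s k = y \<and> (\<forall>j<k. walk m x s j \<noteq> y)) \<and> E s) =
        \<P>(s in steps \<mu>. (walk m x s k = y \<and> (\<forall>j<k. walk m x s j \<noteq> y)) \<and> E' (\<lambda>n. s (k + n)))"
    proof (rule prob_eq_AE)
      show "AE s in steps \<mu>. ((walk m x s k = y \<and> (\<forall>j<k. walk m x s j \<noteq> y)) \<and> E s) \<longleftrightarrow>
          ((walk m x s k = y \<and> (\<forall>j<k. walk m x s j \<noteq> y)) \<and> E' (\<lambda>n. s (k + n)))"
        using AE_steps_in_support by eventually_elim (metis restart)
    qed measurable
    also have "\<dots> = \<P>(s in steps \<mu>. walk m x s k = y \<and> (\<forall>j<k. walk m x s j \<noteq> y)) * \<P>(s in steps \<mu>. E' s)"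
    proof (rule markov)
      fix s s' :: "nat \<Rightarrow> word" assume "\<And>j. j < k \<Longrightarrow> s j = s' j"
      then have "walk m x s j = walk m x s' j" if "j \<le> k" for j
        using that by (intro walk_cong) auto
      then show "(walk m x s k = y \<and> (\<forall>j<k. walk m x s j \<noteq> y)) =
          (walk m x s' k = y \<and> (\<forall>j<k. walk m x s' j \<noteq> y))" by auto
    qed measurable
    finally show ?thesis .
  qed
  then have "\<P>(s in steps \<mu>. (\<exists>k. walk m x s k = y) \<and> E s) = 
     (\<Sum>k. \<P>(s in steps \<mu>. walk m x s k = y \<and> (\<forall>j<k. walk m x s j \<noteq> y)) * \<P>(s in steps \<mu>. E' s))"
    using sums_unique[OF first_visit_sums[of E \<mu> m x y]] by simp
  also have "\<dots> = first_passage m \<mu> x y * \<P>(s in steps \<mu>. E' s)"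
    unfolding first_passage_def
    using sums_summable[OF first_visit_sums[of "\<lambda>_. True" \<mu> m x y]] 
    by (intro suminf_mult2[symmetric]) simp
  finally show ?thesis .
qed

section \<open>The hitting measure\<close>

lemma sets_boundary_space:
  "cylinder m ` carrier (free_group m) \<subseteq> Pow (boundary m)"
  by (auto simp: cylinder_def)

lemma pred_eventually_sequentially [measurable (raw)]:
  "(\<And>k::nat. Measurable.pred M (\<lambda>x. P x k)) \<Longrightarrow>
     Measurable.pred M (\<lambda>x. \<forall>\<^sub>F k in sequentially. P x k)"
  unfolding eventually_sequentially by (intro pred_intros_countable pred_intros_imp')

lemma measurable_stabilizes [measurable]:
  "Measurable.pred (steps \<mu>) (\<lambda>s. stabilizes m (walk m x s))"
  unfolding stabilizes_def
proof (intro pred_intros_countable pred_intros_conj1' pred_eventually_sequentially)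
  fix g k
  have "Measurable.pred (steps \<mu>) (\<lambda>s. walk m x s k \<in> {w \<in> carrier (free_group m). prefix g w})"
    by (rule pred_walk_in)
  then show "Measurable.pred (steps \<mu>) (\<lambda>s. walk m x s k \<in> carrier (free_group m) \<and> prefix g (walk m x s k))"
    by simp
qed

text \<open>Whether the limit point lies in a given cylinder is a countable condition on the positions of the
  path; the default value in the absence of a limit contributes either all or none of such paths.\<close>
lemma measurable_limit_point:
  assumes "m \<ge> 1"
  shows "(\<lambda>s. limit_point m (walk m x s)) \<in> measurable (steps \<mu>) (boundary_space m)"
  unfolding boundary_space_def
proof (rule measurable_measure_of[OF sets_boundary_space])
  show "(\<lambda>s. limit_point m (walk m x s)) \<in> space (steps \<mu>) \<rightarrow> boundary m"
    using limit_point_in_boundary[OF assms] by auto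
  fix A assume "A \<in> cylinder m ` carrier (free_group m)"
  then obtain g where A: "A = cylinder m g" by auto
  let ?default = "\<lambda>n. gen 1 [^]\<^bsub>free_group m\<^esub> (n::nat)"
  have "limit_point m X \<in> cylinder m g \<longleftrightarrow> 
      (if stabilizes m X then \<forall>\<^sub>F k in sequentially. prefix g (X k) else ?default \<in> cylinder m g)" for X
    using limit_point_in_cylinder_iff[of m X g] stabilizes_iff[of m X] by (auto simp: limit_point_def)
  then have "(\<lambda>s. limit_point m (walk m x s)) -` A \<inter> space (steps \<mu>) = 
     {s \<in> space (steps \<mu>). if stabilizes m (walk m x s) 
         then \<forall>\<^sub>F k in sequentially. prefix g (walk m x s k) else ?default \<in> cylinder m g}"
    by (auto simp: A)
  also have "\<dots> \<in> sets (steps \<mu>)" by measurable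
  finally show "(\<lambda>s. limit_point m (walk m x s)) -` A \<inter> space (steps \<mu>) \<in> sets (steps \<mu>)" .
qed

lemma hitting_measure_cylinder:
  assumes "m \<ge> 1" "g \<in> carrier (free_group m)"
    and "AE s in steps \<mu>. stabilizes m (walk m [] s)"
  shows "measure (hitting_measure m \<mu>) (cylinder m g) =
           \<P>(s in steps \<mu>. \<forall>\<^sub>F k in sequentially. prefix g (walk m [] s k))"
proof -
  interpret prob_space "steps \<mu>" by (rule prob_space_steps)
  have cyl: "cylinder m g \<in> sets (boundary_space m)"
    unfolding boundary_space_def using assms(2) sets_boundary_space by (simp add: sets_measure_of)
  note [measurable] = measurable_limit_point[OF assms(1)] this
  have "measure (hitting_measure m \<mu>) (cylinder m g) =
      \<P>(s in steps \<mu>. limit_point m (walk m [] s) \<in> cylinder m g)"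
    unfolding hitting_measure_def
    by (subst measure_distr) (auto intro!: arg_cong[of _ _ "measure _"])
  also have "\<dots> = \<P>(s in steps \<mu>. \<forall>\<^sub>F k in sequentially. prefix g (walk m [] s k))"
  proof (rule prob_eq_AE)
    show "AE s in steps \<mu>. limit_point m (walk m [] s) \<in> cylinder m g \<longleftrightarrow>
        (\<forall>\<^sub>F k in sequentially. prefix g (walk m [] s k))"
      using assms(3) by eventually_elim (rule limit_point_in_cylinder_iff)
  qed measurable
  finally show ?thesis .
qed

section \<open>Transience\<close>

lemma mult_two_letters:
  assumes "reduced_word w" "fst x \<noteq> fst y"
  shows "foldr push w [x, y] = foldr push (foldr push w [x]) [y]"
proof -
  have "y \<noteq> flip x" using assms(2) by auto
  then have "[x, y] = foldr push [x] [y]" "reduced_word [y]" 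
    by (auto simp: push_def reduced_Cons)
  then show ?thesis using mult_assoc[of "[y]" "[x]" w] mult_assoc[of "[x]" "[y]" w]
    by (metis mult_assoc reduced_Cons reduced_Nil)
qed

text \<open>The last inequality is the reason for transience: of two opposite letters at most one cancels.\<close>
lemma length_mult_letter:
  assumes "reduced_word w"
  shows "length (foldr push w [x]) \<le> Suc (length w)" "length w \<le> Suc (length (foldr push w [x]))"
    "fst (last w) \<noteq> fst x \<Longrightarrow> length (foldr push w [x]) = Suc (length w)"
    "length (foldr push w [x]) + length (foldr push w [flip x]) \<ge> 2 * length w"
proof -
  have *: "length w - 1 + Suc (length w) = 2 * length w" if "w \<noteq> []" using that by (cases w) auto
  show "length (foldr push w [x]) + length (foldr push w [flip x]) \<ge> 2 * length w"
    using * by (cases "w = []") (auto simp: mult_letter assms simp del: foldr.simps)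
qed (use assms in \<open>auto simp: mult_letter simp del: foldr.simps\<close>)

text \<open>Opposite double steps satisfy the same inequality: if the first letter of one cancels, then the other
  one is appended without cancellation, which makes up for a loss of at most two.\<close>
lemma length_mult_two_letters:
  assumes w: "reduced_word w" and xy: "fst x \<noteq> fst y"
  shows "length (foldr push w [x, y]) + length (foldr push w [flip x, flip y]) \<ge> 2 * length w"
    and "length (foldr push w [x, y]) \<le> Suc (Suc (length w))"
    and "length w \<le> Suc (Suc (length (foldr push w [x, y])))"
proof -
  have red: "reduced_word (foldr push w [x])" for x by (rule reduced_mult) (simp add: reduced_Cons)
  have split: "foldr push w [x, y] = foldr push (foldr push w [x]) [y]"
    "foldr push w [flip x, flip y] = foldr push (foldr push w [flip x]) [flip y]"
    using w xy by (auto intro!: mult_two_letters simp del: foldr.simps)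
  show le: "length w \<le> Suc (Suc (length (foldr push w [x, y])))"
    "length (foldr push w [x, y]) \<le> Suc (Suc (length w))"
    using length_mult_letter(1,2)[OF w, of x] length_mult_letter(1,2)[OF red, of x y] 
    unfolding split by linarith+
  have le': "length w \<le> Suc (Suc (length (foldr push w [flip x, flip y])))"
    using length_mult_letter(1,2)[OF w, of "flip x"] length_mult_letter(1,2)[OF red, of "flip x" "flip y"]
    unfolding split by linarith
  have grow: "length (foldr push w [z, z']) = Suc (Suc (length w))" 
    if "w = [] \<or> last w \<noteq> flip z" "fst z \<noteq> fst z'" for z z'
  proof -
    have "foldr push w [z] = w @ [z]" using that(1) w by (auto simp: mult_letter simp del: foldr.simps)
    moreover have "length (foldr push (foldr push w [z]) [z']) = Suc (length (foldr push w [z]))"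
      using that by (intro length_mult_letter(3)[OF red]) (simp add: calculation)
    ultimately show ?thesis using mult_two_letters[OF w that(2)] by simp
  qed
  have "w = [] \<or> last w \<noteq> flip x \<or> last w \<noteq> x" using flip_neq(1)[of x] by metis
  then show "length (foldr push w [x, y]) + length (foldr push w [flip x, flip y]) \<ge> 2 * length w"
    using grow[of x y] grow[of "flip x" "flip y"] xy le le' by fastforce
qed

lemma take_mult_letter:
  "reduced_word w \<Longrightarrow> n < length w \<Longrightarrow> take n (foldr push w [x]) = take n w"
  by (auto simp: mult_letter take_butlast)

text \<open>A quadratic upper bound for \<open>t\<^sup>d\<close> with \<open>t = 1/(1 + e)\<close>, valid for all increments \<open>d\<close> between \<open>-2\<close> and \<open>2\<close>.
  Its linear term turns a positive mean increment into exponential decay.\<close>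
lemma power_le_quadratic:
  fixes e :: real and n k :: nat
  assumes e: "e > 0" and nk: "n \<le> Suc (Suc k)" "k \<le> Suc (Suc n)"
  shows "(1 / (1 + e)) ^ n \<le> (1 / (1 + e)) ^ k * (1 - e * (real n - real k) + 3 * e\<^sup>2)"
proof -
  let ?t = "1 / (1 + e)"
  have t: "?t > 0" using e by simp
  have up: "?t \<le> 1 - e + 3 * e\<^sup>2" "?t * ?t \<le> 1 - 2 * e + 3 * e\<^sup>2"
  proof -
    have "1 \<le> (1 - e + 3 * e\<^sup>2) * (1 + e)" using e by (simp add: algebra_simps power2_eq_square)
    then show "?t \<le> 1 - e + 3 * e\<^sup>2" using e by (simp add: field_simps)
    have "(1 - 2 * e + 3 * e\<^sup>2) * ((1 + e) * (1 + e)) = 1 + 4 * (e * e * e) + 3 * (e * e * e * e)"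
      by (simp add: algebra_simps power2_eq_square)
    then have "1 \<le> (1 - 2 * e + 3 * e\<^sup>2) * ((1 + e) * (1 + e))" using e by simp
    then show "?t * ?t \<le> 1 - 2 * e + 3 * e\<^sup>2" using e by (simp add: divide_le_eq)
  qed
  have down: "1 \<le> ?t * (1 + e + 3 * e\<^sup>2)" "1 \<le> ?t * ?t * (1 + 2 * e + 3 * e\<^sup>2)"
  proof -
    show "1 \<le> ?t * (1 + e + 3 * e\<^sup>2)" using e by (simp add: le_divide_eq)
    have "(1 + e) * (1 + e) \<le> 1 + 2 * e + 3 * e\<^sup>2"
      by (simp add: distrib_left distrib_right power2_eq_square)
    then show "1 \<le> ?t * ?t * (1 + 2 * e + 3 * e\<^sup>2)" using e by (simp add: le_divide_eq)
  qed
  consider "n = Suc (Suc k)" | "n = Suc k" | "n = k" | "k = Suc n" | "k = Suc (Suc n)"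
    using nk by linarith
  then show ?thesis
  proof cases
    case 1
    then show ?thesis using mult_left_mono[OF up(2), of "?t ^ k"] t by (simp add: mult_ac)
  next
    case 2
    then show ?thesis using mult_left_mono[OF up(1), of "?t ^ k"] t by (simp add: mult_ac)
  next
    case 3
    then show ?thesis using mult_left_mono[of 1 "1 + 3 * e\<^sup>2" "?t ^ k"] t by simp
  next
    case 4
    then show ?thesis using mult_left_mono[OF down(1), of "?t ^ n"] t by (simp add: mult_ac)
  next
    case 5
    then show ?thesis using mult_left_mono[OF down(2), of "?t ^ n"] t by (simp add: mult_ac)
  qed
qed

lemma walk_reduced:
  assumes "reduced_word x" "\<And>k. reduced_word (s k)"
  shows "reduced_word (walk m x s k)"
  using assms by (induction k) (auto intro: reduced_mult)

locale antisymmetric_walk =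
  fixes m :: nat and \<mu> :: "word pmf"
  assumes two_le_rank: "m \<ge> 2"
    and support: "set_pmf \<mu> =
           (\<Union>i\<in>{1..m}. {gen i, inv\<^bsub>free_group m\<^esub> (gen i)}) \<union>
           {gen 1 \<otimes>\<^bsub>free_group m\<^esub> gen 2,
            inv\<^bsub>free_group m\<^esub> (gen 1) \<otimes>\<^bsub>free_group m\<^esub> inv\<^bsub>free_group m\<^esub> (gen 2)}"
    and antisym: "antisymmetric m \<mu>"
begin

lemma support_eq:
  "set_pmf \<mu> = (\<lambda>x. [x]) ` letters m \<union> {[(1, True), (2, True)], [(1, False), (2, False)]}"
proof -
  have inv: "inv\<^bsub>free_group m\<^esub> (gen i) = [(i, False)]" if "i \<in> {1..m}" for i
    using that inv_letter[of "(i, True)" m] by (simp add: gen_def letters_iff flip_def)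
  have "gen 1 \<otimes>\<^bsub>free_group m\<^esub> gen 2 = [(1, True), (2, True)]"
    by (simp add: gen_def push_def flip_def)
  moreover have "inv\<^bsub>free_group m\<^esub> (gen 1) \<otimes>\<^bsub>free_group m\<^esub> inv\<^bsub>free_group m\<^esub> (gen 2) = [(1, False), (2, False)]"
    using two_le_rank by (simp add: inv push_def flip_def)
  moreover have "(\<Union>i\<in>{1..m}. {gen i, inv\<^bsub>free_group m\<^esub> (gen i)}) = (\<Union>i\<in>{1..m}. {[(i, True)], [(i, False)]})"
    by (rule SUP_cong[OF refl], simp only: inv, simp add: gen_def)
  moreover have "\<dots> = (\<lambda>x. [x]) ` letters m"
    by (auto simp: letters_def image_iff)
  ultimately show ?thesis by (simp add: support)
qed

lemma step_cases:
  assumes "g \<in> set_pmf \<mu>"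
  obtains (letter) x where "x \<in> letters m" "g = [x]"
    | (double) c where "g = [(1, c), (2, c)]"
  using assms by (auto simp: support_eq)

lemma letter_in_support: "x \<in> letters m \<Longrightarrow> [x] \<in> set_pmf \<mu>"
  by (auto simp: support_eq)

lemma step_in_carrier: "g \<in> set_pmf \<mu> \<Longrightarrow> g \<in> carrier (free_group m)"
  by (erule step_cases) (use two_le_rank in \<open>auto simp: carrier_free_group_iff reduced_Cons letters_iff flip_def\<close>)

lemma step_reduced: "g \<in> set_pmf \<mu> \<Longrightarrow> reduced_word g"
  using step_in_carrier by (auto simp: carrier_free_group_iff)

lemma finite_support: "finite (set_pmf \<mu>)"
  by (simp add: support_eq letters_def)

lemma map_hat: "map_pmf hat \<mu> = \<mu>"
proof (rule pmf_eqI)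
  fix g
  have inj: "inj hat" by (rule inj_on_inverseI[of _ hat]) (rule hat_hat)
  have "pmf (map_pmf hat \<mu>) g = pmf (map_pmf hat \<mu>) (hat (hat g))" by (simp add: hat_hat)
  also have "\<dots> = pmf \<mu> (hat g)" using inj by (rule pmf_map_inj')
  also have "\<dots> = pmf \<mu> g"
  proof (cases "g \<in> carrier (free_group m)")
    case True
    then show ?thesis using antisym by (simp add: antisymmetric_def)
  next
    case False
    then have "hat g \<notin> carrier (free_group m)" using hat_carrier[of "hat g" m] by (auto simp: hat_hat)
    with False show ?thesis using step_in_carrier by (metis pmf_eq_0_set_pmf)
  qed
  finally show "pmf (map_pmf hat \<mu>) g = pmf \<mu> g" .
qed

definition min_weight :: real where
  "min_weight = Min ((\<lambda>g. pmf \<mu> g) ` set_pmf \<mu>)"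

lemma min_weight: "min_weight > 0" "g \<in> set_pmf \<mu> \<Longrightarrow> min_weight \<le> pmf \<mu> g"
proof -
  have "min_weight \<in> (\<lambda>g. pmf \<mu> g) ` set_pmf \<mu>"
    unfolding min_weight_def using finite_support by (intro Min_in) (auto simp: set_pmf_not_empty)
  then show "min_weight > 0" by (auto simp: pmf_positive)
qed (simp add: min_weight_def finite_support)

lemma integrable_step [simp]: "integrable (measure_pmf \<mu>) (f :: word \<Rightarrow> real)"
  by (rule integrable_measure_pmf_finite[OF finite_support])

lemma expectation_hat:
  "measure_pmf.expectation \<mu> (\<lambda>g. f (hat g)) = measure_pmf.expectation \<mu> (f :: word \<Rightarrow> real)"
  using integral_map_pmf[of hat \<mu> f] by (simp add: map_hat)

text \<open>Averaging over a step and its image under the involution, no pair shortens the word on average,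
  and each letter of a pair whose index differs from that of the last letter lengthens it by one.\<close>
lemma expected_length:
  assumes w: "reduced_word w"
  shows "length w + min_weight \<le> measure_pmf.expectation \<mu> (\<lambda>g. real (length (foldr push w g)))"
proof -
  let ?D = "\<lambda>g. real (length (foldr push w g)) + length (foldr push w (hat g)) - 2 * length w"
  \<comment> \<open>An index that does not occur in the last letter; it exists because the rank is at least two.\<close>
  define i where "i = (if fst (last w) = 1 then 2 else 1 :: nat)"
  let ?x = "(i, True)"
  have x: "?x \<in> letters m" "fst (last w) \<noteq> fst ?x" using two_le_rank by (auto simp: letters_iff i_def)
  have D: "?D g \<ge> 0" if "g \<in> set_pmf \<mu>" for g
    using that
  proof (cases rule: step_cases)
    case (letter x)
    then show ?thesis using length_mult_letter(4)[OF w, of x] by (simp add: hat_def del: foldr.simps)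
  next
    case (double c)
    then show ?thesis using length_mult_two_letters(1)[OF w, of "(1, c)" "(2, c)"] 
      by (simp add: hat_def del: foldr.simps)
  qed
  have Dx: "?D [?x] = 2"
    using length_mult_letter(3)[OF w, of ?x] length_mult_letter(3)[OF w, of "flip ?x"] x(2)
    by (simp add: hat_def del: foldr.simps)
  have "2 * min_weight \<le> 2 * pmf \<mu> [?x]"
    using min_weight(2)[OF letter_in_support[OF x(1)]] by simp
  also have "\<dots> = pmf \<mu> [?x] * ?D [?x]" unfolding Dx by simp
  also have "\<dots> \<le> (\<Sum>g\<in>set_pmf \<mu>. pmf \<mu> g * ?D g)"
    using D by (intro member_le_sum[OF letter_in_support[OF x(1)]]) (auto simp: finite_support)
  also have "\<dots> = measure_pmf.expectation \<mu> ?D"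
    using finite_support by (subst integral_measure_pmf[of "set_pmf \<mu>"]) auto
  also have "\<dots> = 2 * measure_pmf.expectation \<mu> (\<lambda>g. real (length (foldr push w g))) - 2 * length w"
    using expectation_hat[of "\<lambda>g. real (length (foldr push w g))"] by simp
  finally show ?thesis by simp
qed

definition base :: real where "base = 1 / (1 + min_weight / 6)"
text \<open>With \<open>e = p/6\<close> and mean increment at least \<open>p\<close>, the bound \<open>1 - e p + 3 e\<^sup>2\<close> for the decay factor is
  \<open>1 - p\<^sup>2/12\<close>; this choice of \<open>e\<close> minimizes it.\<close>
definition rate :: real where "rate = 1 - min_weight\<^sup>2 / 12"

lemma min_weight_le_1: "min_weight \<le> 1"
proof -
  obtain g where "g \<in> set_pmf \<mu>" using set_pmf_not_empty by fast
  from min_weight(2)[OF this] show ?thesis using pmf_le_1[of \<mu> g] by linarith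
qed

lemma base_rate: "0 < base" "base < 1" "0 \<le> rate" "rate < 1"
  using min_weight(1) min_weight_le_1 power_le_one[of min_weight 2] by (auto simp: base_def rate_def field_simps)

lemma length_step:
  assumes w: "reduced_word w" and "g \<in> set_pmf \<mu>"
  shows "length (foldr push w g) \<le> Suc (Suc (length w))" "length w \<le> Suc (Suc (length (foldr push w g)))"
proof -
  from assms(2) have "length (foldr push w g) \<le> Suc (Suc (length w)) \<and> length w \<le> Suc (Suc (length (foldr push w g)))"
  proof (cases rule: step_cases)
    case (letter x)
    then show ?thesis using length_mult_letter(1,2)[OF w, of x] by (simp del: foldr.simps)
  next
    case (double c)
    then show ?thesis using length_mult_two_letters(2,3)[OF w, of "(1, c)" "(2, c)"] by (simp del: foldr.simps)
  qed
  then show "length (foldr push w g) \<le> Suc (Suc (length w))" "length w \<le> Suc (Suc (length (foldr push w g)))"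
    by auto
qed

lemma expectation_base_power:
  assumes w: "reduced_word w"
  shows "measure_pmf.expectation \<mu> (\<lambda>g. base ^ length (foldr push w g)) \<le> rate * base ^ length w"
proof -
  let ?e = "min_weight / 6"
  have e: "?e > 0" using min_weight(1) by simp
  have "measure_pmf.expectation \<mu> (\<lambda>g. base ^ length (foldr push w g)) \<le> 
     measure_pmf.expectation \<mu> (\<lambda>g. base ^ length w * 
       (1 - ?e * (real (length (foldr push w g)) - real (length w)) + 3 * ?e\<^sup>2))"
    unfolding base_def
    by (intro integral_mono_AE integrable_step AE_pmfI power_le_quadratic[OF e] length_step[OF w])
  also have "\<dots> = base ^ length w * 
      (1 - ?e * (measure_pmf.expectation \<mu> (\<lambda>g. real (length (foldr push w g))) - real (length w)) + 3 * ?e\<^sup>2)"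
    by simp
  also have "\<dots> \<le> base ^ length w * (1 - ?e * min_weight + 3 * ?e\<^sup>2)"
    using expected_length[OF w] e base_rate(1)
    by (intro mult_left_mono add_mono diff_mono) auto
  also have "\<dots> = rate * base ^ length w"
    by (simp add: rate_def power2_eq_square field_simps)
  finally show ?thesis .
qed

text \<open>Conditioning on the first step, so that the induction runs over all starting points at once.\<close>
lemma nn_integral_base_power_walk:
  "reduced_word x \<Longrightarrow> (\<integral>\<^sup>+s. ennreal (base ^ length (walk m x s k)) \<partial>steps \<mu>) \<le> ennreal (rate ^ k * base ^ length x)"
proof (induction k arbitrary: x)
  case 0
  interpret prob_space "steps \<mu>" by (rule prob_space_steps)
  show ?case by (simp add: emeasure_space_1[simplified])
next
  case (Suc k)
  interpret seq: sequence_space "measure_pmf \<mu>" by unfold_locales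
  interpret prob_space "steps \<mu>" by (rule prob_space_steps)
  have iter: "distr (measure_pmf \<mu> \<Otimes>\<^sub>M steps \<mu>) (steps \<mu>) (\<lambda>(g, s). case_nat g s) = steps \<mu>"
    unfolding steps_def by (rule seq.PiM_iter)
  have [measurable]: "(\<lambda>(g, s). case_nat g s) \<in> measurable (measure_pmf \<mu> \<Otimes>\<^sub>M steps \<mu>) (steps \<mu>)"
    unfolding steps_def by measurable
  have meas: "(\<lambda>s. ennreal (base ^ length (walk m x s k))) \<in> borel_measurable (steps \<mu>)" for x k
    by (rule measurable_compose[OF measurable_walk]) simp
  have first: "walk m x (case_nat g s) (Suc k) = walk m (foldr push x g) s k" for g s
    using walk_shift[of m x "case_nat g s" 1 k] by simp
  have "(\<integral>\<^sup>+s. ennreal (base ^ length (walk m x s (Suc k))) \<partial>steps \<mu>) =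
      (\<integral>\<^sup>+(g, s). ennreal (base ^ length (walk m x (case_nat g s) (Suc k))) \<partial>(measure_pmf \<mu> \<Otimes>\<^sub>M steps \<mu>))"
    by (subst iter[symmetric], subst nn_integral_distr) (auto intro!: meas simp: case_prod_beta' simp del: walk.simps)
  also have "\<dots> = (\<integral>\<^sup>+g. (\<integral>\<^sup>+s. ennreal (base ^ length (walk m x (case_nat g s) (Suc k))) \<partial>steps \<mu>) \<partial>measure_pmf \<mu>)"
    using measurable_compose[OF _ meas, of "\<lambda>(g, s). case_nat g s" "measure_pmf \<mu> \<Otimes>\<^sub>M steps \<mu>" x "Suc k"]
    by (subst nn_integral_fst[symmetric]) (auto simp: case_prod_beta' simp del: walk.simps)
  also have "\<dots> \<le> (\<integral>\<^sup>+g. ennreal (rate ^ k * base ^ length (foldr push x g)) \<partial>measure_pmf \<mu>)"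
    unfolding first
    by (intro nn_integral_mono_AE AE_pmfI Suc.IH reduced_mult step_reduced)
  also have "\<dots> = ennreal (measure_pmf.expectation \<mu> (\<lambda>g. rate ^ k * base ^ length (foldr push x g)))"
    using base_rate by (intro nn_integral_eq_integral) auto
  also have "\<dots> \<le> ennreal (rate ^ k * (rate * base ^ length x))"
    using expectation_base_power[OF Suc.prems] base_rate by (intro ennreal_leI) (simp add: mult_left_mono)
  finally show ?case by (simp add: mult_ac)
qed

lemma prob_short:
  "measure (steps \<mu>) {s. length (walk m [] s k) \<le> n} \<le> rate ^ k / base ^ n"
proof -
  interpret prob_space "steps \<mu>" by (rule prob_space_steps)
  let ?A = "{s. length (walk m [] s k) \<le> n}"
  have A: "?A \<in> sets (steps \<mu>)" by (intro Collect_in_sets_steps pred_walk)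
  have "ennreal (base ^ n * measure (steps \<mu>) ?A) = ennreal (base ^ n) * emeasure (steps \<mu>) ?A"
    using base_rate(1) by (simp add: emeasure_eq_measure ennreal_mult)
  also have "\<dots> = (\<integral>\<^sup>+s. ennreal (base ^ n) * indicator ?A s \<partial>steps \<mu>)"
    using A by (simp add: nn_integral_cmult_indicator)
  also have "\<dots> \<le> (\<integral>\<^sup>+s. ennreal (base ^ length (walk m [] s k)) \<partial>steps \<mu>)"
    using base_rate by (intro nn_integral_mono) (auto split: split_indicator intro!: ennreal_leI power_decreasing)
  also have "\<dots> \<le> ennreal (rate ^ k)" using nn_integral_base_power_walk[of "[]" k] by simp
  finally have "base ^ n * measure (steps \<mu>) ?A \<le> rate ^ k" using base_rate by simp
  then show ?thesis using base_rate by (simp add: field_simps)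
qed

lemma AE_length_walk: "AE s in steps \<mu>. \<forall>n. \<forall>\<^sub>F k in sequentially. n < length (walk m [] s k)"
proof -
  interpret prob_space "steps \<mu>" by (rule prob_space_steps)
  have "AE s in steps \<mu>. \<forall>\<^sub>F k in sequentially. n < length (walk m [] s k)" for n
  proof -
    have "summable (\<lambda>k. measure (steps \<mu>) {s. length (walk m [] s k) \<le> n})"
    proof (rule summable_comparison_test')
      show "summable (\<lambda>k. rate ^ k / base ^ n)"
        using base_rate by (intro summable_divide summable_geometric) simp
    qed (use prob_short in simp)
    then have "AE s in steps \<mu>. \<forall>\<^sub>F k in sequentially. s \<in> space (steps \<mu>) - {s. length (walk m [] s k) \<le> n}"
      by (intro borel_cantelli_AE1 Collect_in_sets_steps pred_walk) (simp_all add: emeasure_eq_measure)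
    then show ?thesis by (simp add: not_le)
  qed
  then show ?thesis by (simp add: AE_all_countable)
qed

lemma walk_in_carrier:
  assumes "x \<in> carrier (free_group m)" "\<And>k. s k \<in> set_pmf \<mu>"
  shows "walk m x s k \<in> carrier (free_group m)"
proof (induction k)
  case (Suc k)
  interpret group "free_group m" by (rule group_free_group)
  show ?case using m_closed[OF Suc step_in_carrier[OF assms(2)]] by simp
qed (use assms in simp)

lemma take_step:
  assumes w: "reduced_word w" and "g \<in> set_pmf \<mu>" and n: "Suc n < length w"
  shows "take n (foldr push w g) = take n w"
  using assms(2)
proof (cases rule: step_cases)
  case (letter x)
  then show ?thesis using take_mult_letter[OF w] n by (simp del: foldr.simps)
next
  case (double c)
  let ?w = "foldr push w [(1, c)]"
  have "reduced_word ?w" by (rule reduced_mult) (simp add: reduced_Cons)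
  moreover have "n < length ?w" using length_mult_letter(2)[OF w, of "(1, c)"] n by linarith
  ultimately have "take n (foldr push ?w [(2, c)]) = take n ?w" by (rule take_mult_letter)
  also have "\<dots> = take n w" using n by (intro take_mult_letter[OF w]) simp
  finally show ?thesis using mult_two_letters[OF w, of "(1, c)" "(2, c)"] double by simp
qed

text \<open>A step alters at most the last two letters, so once the length stays above \<open>n + 1\<close> the first \<open>n\<close>
  letters no longer change.\<close>
lemma stabilizes_if_length:
  assumes s: "\<And>k. s k \<in> set_pmf \<mu>" 
    and len: "\<And>n. \<forall>\<^sub>F k in sequentially. n < length (walk m [] s k)"
  shows "stabilizes m (walk m [] s)"
  unfolding stabilizes_def
proof
  fix n
  from len[of "Suc n"] obtain K where K: "\<And>k. k \<ge> K \<Longrightarrow> Suc n < length (walk m [] s k)"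
    unfolding eventually_sequentially by blast
  have car: "walk m [] s k \<in> carrier (free_group m)" for k
    using s by (intro walk_in_carrier) (auto simp: carrier_free_group_iff)
  have "take n (walk m [] s k) = take n (walk m [] s K)" if "k \<ge> K" for k
    using that
  proof (induction rule: dec_induct)
    case (step k)
    then show ?case using take_step[OF _ s K[of k], of k] car[of k] by (simp add: carrier_free_group_iff)
  qed simp
  then have "prefix (take n (walk m [] s K)) (walk m [] s k)" if "k \<ge> K" for k
    using that by (metis take_is_prefix)
  moreover have "length (take n (walk m [] s K)) = n" using K[of K] by simp
  ultimately show "\<exists>g. length g = n \<and> (\<forall>\<^sub>F k in sequentially. walk m [] s k \<in> carrier (free_group m) \<and> prefix g (walk m [] s k))"
    using car unfolding eventually_sequentially by (intro exI[of _ "take n (walk m [] s K)"] conjI exI[of _ K]) auto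
qed

lemma AE_stabilizes: "AE s in steps \<mu>. stabilizes m (walk m [] s)"
  using AE_steps_in_support AE_length_walk by eventually_elim (rule stabilizes_if_length, auto)

end

section \<open>Entering and leaving cones\<close>

lemma prefix_single_iff: "prefix [x] w \<longleftrightarrow> w \<noteq> [] \<and> hd w = x"
  by (cases w) auto

text \<open>Left translation by \<open>x\<close> maps the complement of the cone of \<open>x\<inverse>\<close> onto the cone of \<open>x\<close>.\<close>
lemma prefix_push_iff:
  "reduced_word w \<Longrightarrow> prefix [x] (push x w) \<longleftrightarrow> \<not> prefix [flip x] w"
  by (cases w) (auto simp: prefix_single_iff push_def reduced_Cons)

lemma push_eq_iff:
  assumes "reduced_word v" "reduced_word w"
  shows "push x v = push x w \<longleftrightarrow> v = w"
  using push_flip[OF assms(1)] push_flip[OF assms(2)] by metis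

lemma enter_cone_letter:
  assumes "reduced_word w" "\<not> prefix [x] w" "prefix [x] (foldr push w [y])"
  shows "w = [] \<and> y = x"
proof (cases "w \<noteq> [] \<and> last w = flip y")
  case True
  then have "prefix [x] (butlast w)" using assms by (simp add: mult_letter del: foldr.simps)
  then have "prefix [x] w" using prefix_order.trans prefixeq_butlast by blast
  with assms show ?thesis by simp
next
  case False
  then have "prefix [x] (w @ [y])" using assms(1,3) unfolding mult_letter[OF assms(1)] by presburger
  with assms(2) show ?thesis by (cases w) auto
qed

lemma leave_cone_letter:
  assumes "reduced_word w" "prefix p w" "\<not> prefix p (foldr push w [y])"
  shows "w = p \<and> p \<noteq> [] \<and> y = flip (last p) \<and> foldr push w [y] = butlast p"
proof (cases "w \<noteq> [] \<and> last w = flip y")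
  case True
  then have but: "foldr push w [y] = butlast w" using assms by (simp add: mult_letter del: foldr.simps)
  have "w = p"
  proof (rule ccontr)
    assume "w \<noteq> p"
    with assms(2) True have "prefix p (butlast w)"
      by (metis append_butlast_last_id prefix_snoc)
    with assms(3) but show False by simp
  qed
  with True but show ?thesis by simp
next
  case False
  then have "foldr push w [y] = w @ [y]" using mult_letter[OF assms(1), of y] by presburger
  with assms(2,3) show ?thesis by simp
qed

lemma walk_translate:
  assumes "reduced_word x" "\<And>k. reduced_word (s k)"
  shows "walk m x s k = foldr push x (walk m [] s k)"
proof (induction k)
  case (Suc k)
  have "reduced_word (walk m [] s k)" using assms(2) by (intro walk_reduced) auto
  with Suc show ?case using assms by (simp add: mult_assoc)
qed (use assms in \<open>simp add: mult_Nil\<close>)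

lemma walk_hat: "walk m [] (\<lambda>n. hat (s n)) k = hat (walk m [] s k)"
proof (induction k)
  case 0
  then show ?case by (simp add: hat_def)
qed (simp add: hat_mult)

text \<open>A convergent path either ends up in a given cone or leaves it for good.\<close>
lemma stabilizes_eventually_not_prefix:
  assumes "stabilizes m X"
  shows "(\<forall>\<^sub>F k in sequentially. \<not> prefix [y] (X k)) \<longleftrightarrow> \<not> (\<forall>\<^sub>F k in sequentially. prefix [y] (X k))"
proof -
  from assms obtain g where len: "length g = 1" and 
    g: "\<forall>\<^sub>F k in sequentially. X k \<in> carrier (free_group m) \<and> prefix g (X k)"
    unfolding stabilizes_def by blast
  have g: "\<forall>\<^sub>F k in sequentially. prefix g (X k)"
    using g by (rule eventually_mono) simp
  show ?thesis
  proof (cases "g = [y]")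
    case True
    have "\<not> (\<forall>\<^sub>F k in sequentially. \<not> prefix [y] (X k))"
    proof
      assume "\<forall>\<^sub>F k in sequentially. \<not> prefix [y] (X k)"
      with g have "\<forall>\<^sub>F k in sequentially. False" by eventually_elim (simp add: True)
      then show False by simp
    qed
    with g True show ?thesis by simp
  next
    case False
    have "\<forall>\<^sub>F k in sequentially. \<not> prefix [y] (X k)"
      using g by (rule eventually_mono) (use False len prefix_antisym_length[of g _ "[y]"] in auto)
    moreover have "\<not> (\<forall>\<^sub>F k in sequentially. prefix [y] (X k))"
      using eventually_prefix_unique[OF g, of "[y]"] False len by auto
    ultimately show ?thesis by simp
  qed
qed

lemma prob_first_step: "\<P>(s in steps \<mu>. s 0 = g) = pmf \<mu> g"
proof -
  have "pmf \<mu> g = measure (distr (steps \<mu>) (measure_pmf \<mu>) (\<lambda>s. s 0)) {g}"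
    unfolding steps_def by (subst distr_PiM_component) (auto simp: measure_pmf_single intro: measure_pmf.prob_space_axioms)
  also have "\<dots> = measure (steps \<mu>) ((\<lambda>s. s 0) -` {g} \<inter> space (steps \<mu>))"
    using measurable_step[of 0 \<mu>] by (subst measure_distr) (auto cong: measurable_cong_sets)
  finally show ?thesis by (simp add: vimage_def)
qed

text \<open>The region to which the walk is confined until its first visit to \<open>x\<close>: the complement of the cone
  of \<open>x\<close>, enlarged by the cone behind the landing point of the double step if that step begins with \<open>x\<close>.\<close>
definition before_letter :: "letter \<Rightarrow> word \<Rightarrow> bool" where
  "before_letter x w \<longleftrightarrow> \<not> prefix [x] w \<or> fst x = 1 \<and> prefix [x, (2, snd x)] w"

text \<open>The case distinction in the conclusion locates the two exits: the identity and the landing point of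
  the double step. It is needed because a double step is treated as two successive letters.\<close>
lemma before_letter_mult_letter:
  assumes "reduced_word w" "before_letter x w" "\<not> before_letter x (foldr push w [y])"
  shows "foldr push w [y] = [x] \<and> (w = [] \<and> y = x \<or> fst x = 1 \<and> fst y = 2)"
proof (cases "prefix [x] w")
  case False
  with assms enter_cone_letter[of w x y] show ?thesis
    by (auto simp: before_letter_def)
next
  case True
  with assms(2) have "fst x = 1" "prefix [x, (2, snd x)] w" by (auto simp: before_letter_def)
  with assms leave_cone_letter[of w "[x, (2, snd x)]" y] show ?thesis
    by (auto simp: before_letter_def flip_def simp del: foldr.simps)
qed

context antisymmetric_walk
begin

text \<open>Double steps are no exception, although they need not stop at the word between their two letters:
  the first letter can lead out of the region only from the identity, and then the second letter
  leads back into it.\<close>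
lemma before_letter_step:
  assumes w: "reduced_word w" and g: "g \<in> set_pmf \<mu>"
    and B: "before_letter x w" "\<not> before_letter x (foldr push w g)"
  shows "foldr push w g = [x]"
  using g
proof (cases rule: step_cases)
  case (letter y)
  with before_letter_mult_letter[OF w B(1)] B(2) show ?thesis by blast
next
  case (double c)
  let ?w = "foldr push w [(1, c)]"
  have eq: "foldr push w g = foldr push ?w [(2, c)]"
    using mult_two_letters[OF w, of "(1, c)" "(2, c)"] double by simp
  have red: "reduced_word ?w" by (rule reduced_mult) (simp add: reduced_Cons)
  have "before_letter x ?w"
  proof (rule ccontr)
    assume "\<not> before_letter x ?w"
    from before_letter_mult_letter[OF w B(1) this] have "w = []" "x = (1, c)" by auto
    with B(2) double show False by (auto simp: before_letter_def push_def flip_def)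
  qed
  with before_letter_mult_letter[OF red this] B(2) eq show ?thesis by metis
qed

lemma visits_letter:
  assumes s: "\<And>k. s k \<in> set_pmf \<mu>" and "\<not> before_letter x (walk m [] s k)"
  shows "\<exists>j\<le>k. walk m [] s j = [x]"
  using assms(2)
proof (induction k)
  case 0
  then show ?case by (simp add: before_letter_def)
next
  case (Suc k)
  show ?case
  proof (cases "before_letter x (walk m [] s k)")
    case True
    have "reduced_word (walk m [] s k)" using s by (intro walk_reduced) (auto intro: step_reduced)
    from before_letter_step[OF this s True, of k] Suc.prems have "walk m [] s (Suc k) = [x]" by simp
    then show ?thesis by blast
  next
    case False
    from Suc.IH[OF this] show ?thesis by (meson le_SucI)
  qed
qed

text \<open>The cone of \<open>xy\<close> can only be left through \<open>x\<close> since a double step starts with a letter of index one,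
  which does not cancel \<open>y\<close>.\<close>
lemma leave_cone_step:
  assumes w: "reduced_word w" and g: "g \<in> set_pmf \<mu>"
    and "prefix [x, y] w" "fst y \<noteq> 1" "foldr push w g \<noteq> [x]"
  shows "prefix [x, y] (foldr push w g)"
proof (rule ccontr)
  assume leave: "\<not> prefix [x, y] (foldr push w g)"
  from g show False
  proof (cases rule: step_cases)
    case (letter z)
    with leave_cone_letter[OF w assms(3), of z] leave assms(5) show False by simp
  next
    case (double c)
    let ?w = "foldr push w [(1, c)]"
    have eq: "foldr push w g = foldr push ?w [(2, c)]"
      using mult_two_letters[OF w, of "(1, c)" "(2, c)"] double by simp
    have red: "reduced_word ?w" by (rule reduced_mult) (simp add: reduced_Cons)
    have "prefix [x, y] ?w"
      using leave_cone_letter[OF w assms(3), of "(1, c)"] assms(4) by (auto simp: flip_def)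
    from leave_cone_letter[OF red this, of "(2, c)"] leave assms(5) eq show False by simp
  qed
qed

section \<open>First passage and the measure of cones\<close>

abbreviation passage :: "letter \<Rightarrow> real" where
  "passage x \<equiv> first_passage m \<mu> [] [x]"

definition cone_limit :: "letter \<Rightarrow> (nat \<Rightarrow> word) \<Rightarrow> bool" where
  "cone_limit x X \<longleftrightarrow> (\<forall>\<^sub>F k in sequentially. prefix [x] (X k))"

definition cone_measure :: "letter \<Rightarrow> real" where
  "cone_measure x = \<P>(s in steps \<mu>. cone_limit x (walk m [] s))"

lemma pred_cone_limit [measurable]: "Measurable.pred (steps \<mu>) (\<lambda>s. cone_limit x (walk m y s))"
  unfolding cone_limit_def by (intro pred_eventually_sequentially pred_prefix_walk)

lemma measure_cylinder:
  "x \<in> letters m \<Longrightarrow> measure (hitting_measure m \<mu>) (cylinder m [x]) = cone_measure x"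
  using hitting_measure_cylinder[of m "[x]" \<mu>] two_le_rank AE_stabilizes
  by (simp add: letter_in_carrier cone_limit_def cone_measure_def)

lemma cone_measure_flip: "cone_measure (flip x) = cone_measure x"
proof -
  have "prefix [flip x] (hat w) \<longleftrightarrow> prefix [x] w" for w
    by (cases w) (auto simp: hat_def)
  then have "cone_limit (flip x) (walk m [] (\<lambda>n. hat (s n))) \<longleftrightarrow> cone_limit x (walk m [] s)" for s
    by (simp add: cone_limit_def walk_hat)
  with prob_steps_map[OF map_hat, of "\<lambda>s. cone_limit (flip x) (walk m [] s)"] show ?thesis
    by (simp add: cone_measure_def)
qed

lemma passage_flip: "passage (flip x) = passage x"
proof -
  have "hat w = [flip x] \<longleftrightarrow> w = [x]" for w
    by (cases w) (auto simp: hat_def)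
  then have "(\<exists>k. walk m [] (\<lambda>n. hat (s n)) k = [flip x]) \<longleftrightarrow> (\<exists>k. walk m [] s k = [x])" for s
    by (simp add: walk_hat)
  moreover have "Measurable.pred (steps \<mu>) (\<lambda>s. \<exists>k. walk m [] s k = [flip x])" by measurable
  ultimately show ?thesis
    using prob_steps_map[OF map_hat, of "\<lambda>s. \<exists>k. walk m [] s k = [flip x]"]
    by (simp add: first_passage_eq_prob_hit)
qed

text \<open>Translating by \<open>x\<close> turns the event into the complement of the limit lying in the cone of \<open>x\<inverse>\<close>,
  whose probability antisymmetry identifies.\<close>
lemma prob_return_to_cone:
  "\<P>(s in steps \<mu>. cone_limit x (walk m [x] s)) = 1 - cone_measure x"
proof -
  interpret prob_space "steps \<mu>" by (rule prob_space_steps)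
  have "AE s in steps \<mu>. cone_limit x (walk m [x] s) \<longleftrightarrow> \<not> cone_limit (flip x) (walk m [] s)"
    using AE_stabilizes AE_steps_in_support
  proof eventually_elim
    case (elim s)
    then have red: "reduced_word (s k)" for k by (auto intro: step_reduced)
    have "walk m [x] s k = push x (walk m [] s k)" for k
      using walk_translate[of "[x]" s m k] red by (simp add: reduced_Cons)
    moreover have "reduced_word (walk m [] s k)" for k using red by (intro walk_reduced) auto
    ultimately show ?case
      unfolding cone_limit_def
      using stabilizes_eventually_not_prefix[OF elim(1), of "flip x"] by (simp add: prefix_push_iff)
  qed
  then have "\<P>(s in steps \<mu>. cone_limit x (walk m [x] s)) = 
      \<P>(s in steps \<mu>. \<not> cone_limit (flip x) (walk m [] s))"
    by (intro prob_eq_AE) measurable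
  also have "\<dots> = 1 - cone_measure (flip x)"
    unfolding cone_measure_def by (rule prob_neg) measurable
  finally show ?thesis by (simp add: cone_measure_flip)
qed

lemma prob_visit_and_cone_limit:
  "\<P>(s in steps \<mu>. (\<exists>k. walk m [] s k = [x]) \<and> cone_limit x (walk m [] s)) = passage x * (1 - cone_measure x)"
proof -
  have "\<P>(s in steps \<mu>. (\<exists>k. walk m [] s k = [x]) \<and> cone_limit x (walk m [] s)) =
      passage x * \<P>(s in steps \<mu>. cone_limit x (walk m [x] s))"
  proof (rule strong_markov)
    fix s k assume "walk m [] s k = [x]"
    then have "walk m [] s (n + k) = walk m [x] (\<lambda>n. s (k + n)) n" for n
      using walk_shift[of m "[]" s k n] by (simp add: add.commute)
    then show "cone_limit x (walk m [] s) \<longleftrightarrow> cone_limit x (walk m [x] (\<lambda>n. s (k + n)))"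
      unfolding cone_limit_def
      using eventually_sequentially_seg[of "\<lambda>k. prefix [x] (walk m [] s k)" k] by simp
  qed measurable
  then show ?thesis unfolding prob_return_to_cone .
qed

text \<open>A path ending in the cone of \<open>x\<close> has entered it, and for an index other than one the entry
  is at \<open>x\<close>.\<close>
lemma cone_measure_eq_passage:
  assumes "fst x \<noteq> 1"
  shows "cone_measure x = passage x * (1 - cone_measure x)"
proof -
  interpret prob_space "steps \<mu>" by (rule prob_space_steps)
  have "AE s in steps \<mu>. cone_limit x (walk m [] s) \<longleftrightarrow> 
      (\<exists>k. walk m [] s k = [x]) \<and> cone_limit x (walk m [] s)"
    using AE_steps_in_support
  proof eventually_elim
    case (elim s)
    have "\<exists>k. walk m [] s k = [x]" if "cone_limit x (walk m [] s)"
    proof -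
      from eventually_happens'[OF sequentially_bot that[unfolded cone_limit_def]]
      obtain k where "prefix [x] (walk m [] s k)" by auto
      with assms have "\<not> before_letter x (walk m [] s k)" by (simp add: before_letter_def)
      with visits_letter elim show ?thesis by blast
    qed
    then show ?case by blast
  qed
  then have "cone_measure x = \<P>(s in steps \<mu>. (\<exists>k. walk m [] s k = [x]) \<and> cone_limit x (walk m [] s))"
    unfolding cone_measure_def by (intro prob_eq_AE) measurable
  then show ?thesis unfolding prob_visit_and_cone_limit .
qed

lemma sum_cone_measure_le_1:
  assumes "finite A"
  shows "(\<Sum>x\<in>A. cone_measure x) \<le> 1"
proof -
  interpret prob_space "steps \<mu>" by (rule prob_space_steps)
  let ?L = "\<lambda>x. {s. cone_limit x (walk m [] s)}"
  have unique: "x = y" if "cone_limit x X" "cone_limit y X" for x y X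
    using eventually_prefix_unique[of "[x]" X "[y]"] that by (simp add: cone_limit_def)
  have "disjoint_family_on ?L A"
    unfolding disjoint_family_on_def using unique by blast
  then have "(\<Sum>x\<in>A. measure (steps \<mu>) (?L x)) = measure (steps \<mu>) (\<Union>x\<in>A. ?L x)"
    using assms by (intro finite_measure_finite_Union[symmetric]) (auto intro: Collect_in_sets_steps pred_cone_limit)
  then show ?thesis by (simp add: cone_measure_def)
qed

text \<open>Four disjoint cones, of equal measure in opposite pairs.\<close>
lemma cone_measure_pair_le:
  assumes "fst x \<noteq> fst y"
  shows "2 * cone_measure x + 2 * cone_measure y \<le> 1"
proof -
  have "distinct [x, flip x, y, flip y]" using assms by auto
  then have "(\<Sum>z\<in>{x, flip x, y, flip y}. cone_measure z) = cone_measure x + cone_measure (flip x) + cone_measure y + cone_measure (flip y)"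
    by simp
  with sum_cone_measure_le_1[of "{x, flip x, y, flip y}"] show ?thesis by (simp add: cone_measure_flip)
qed

lemma passage_pos:
  assumes "x \<in> letters m"
  shows "passage x > 0"
proof -
  interpret prob_space "steps \<mu>" by (rule prob_space_steps)
  have "0 < pmf \<mu> [x]" using letter_in_support[OF assms] by (simp add: pmf_positive)
  also have "\<dots> = \<P>(s in steps \<mu>. s 0 = [x])" by (rule prob_first_step[symmetric])
  also have "\<dots> \<le> passage x"
    unfolding first_passage_eq_prob_hit
  proof (rule finite_measure_mono)
    have "walk m [] s 1 = [x]" if "s 0 = [x]" for s using that by (simp)
    then show "{s \<in> space (steps \<mu>). s 0 = [x]} \<subseteq> {s \<in> space (steps \<mu>). \<exists>k. walk m [] s k = [x]}" by blast
  qed measurable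
  finally show ?thesis .
qed

lemma cone_measure_half: "cone_measure x \<le> 1 / 2"
proof -
  have "\<exists>y :: letter. fst x \<noteq> fst y" by (intro exI[of _ "(Suc (fst x), True)"]) simp
  then obtain y :: letter where "fst x \<noteq> fst y" ..
  have "0 \<le> cone_measure y" by (simp add: cone_measure_def)
  with cone_measure_pair_le[OF \<open>fst x \<noteq> fst y\<close>] show ?thesis by simp
qed

lemma cone_measure_ge_passage: "passage x * (1 - cone_measure x) \<le> cone_measure x"
proof -
  interpret prob_space "steps \<mu>" by (rule prob_space_steps)
  have "\<P>(s in steps \<mu>. (\<exists>k. walk m [] s k = [x]) \<and> cone_limit x (walk m [] s)) \<le> cone_measure x"
    unfolding cone_measure_def
    by (rule finite_measure_mono) (auto intro: Collect_in_sets_steps pred_cone_limit)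
  then show ?thesis unfolding prob_visit_and_cone_limit .
qed

lemma cone_measure_pos: "x \<in> letters m \<Longrightarrow> cone_measure x > 0"
  using cone_measure_ge_passage[of x] passage_pos[of x] cone_measure_half[of x]
  by (smt (verit) mult_pos_pos field_sum_of_halves)

text \<open>Another pair of cones has positive measure, so \<open>\<nu>(x) < 1/2\<close> and \<open>\<nu>(x)/(1 - \<nu>(x)) < 1\<close>.\<close>
lemma passage_less_1:
  assumes "x \<in> letters m" "fst x \<noteq> 1"
  shows "passage x < 1"
proof -
  have "(1, True) \<in> letters m" using two_le_rank by (simp add: letters_iff)
  with cone_measure_pos have "cone_measure (1, True) > 0" .
  with cone_measure_pair_le[of x "(1, True)"] assms(2) have less: "cone_measure x < 1 - cone_measure x" by simp
  show ?thesis
  proof (rule ccontr)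
    assume "\<not> passage x < 1"
    then have "1 * (1 - cone_measure x) \<le> passage x * (1 - cone_measure x)"
      using cone_measure_half[of x] by (intro mult_right_mono) auto
    with cone_measure_eq_passage[OF assms(2)] less show False by simp
  qed
qed

text \<open>The excess is at least the probability of starting with the double step and never returning to
  the letter that was jumped over. After translation, not returning means never visiting the
  inverse of the second letter of the double step.\<close>
lemma cone_measure_gt_passage: "passage (1, c) * (1 - cone_measure (1, c)) < cone_measure (1, c)"
proof -
  interpret prob_space "steps \<mu>" by (rule prob_space_steps)
  let ?x = "(1, c) :: letter" and ?z = "(2, c) :: letter"
  let ?miss = "\<lambda>s. \<forall>k. walk m [?x, ?z] s k \<noteq> [?x]"
  have z: "?z \<in> letters m" using two_le_rank by (simp add: letters_iff)
  have hit_z: "Measurable.pred (steps \<mu>) (\<lambda>s. \<exists>k. walk m [] s k = [flip ?z])" by measurable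
  have miss [measurable]: "Measurable.pred (steps \<mu>) ?miss" by measurable
  have red: "reduced_word [?x, ?z]" by (simp add: reduced_Cons flip_def)
  have "AE s in steps \<mu>. ?miss s \<longleftrightarrow> \<not> (\<exists>k. walk m [] s k = [flip ?z])"
    using AE_steps_in_support
  proof eventually_elim
    case (elim s)
    then have reds: "reduced_word (s k)" for k by (auto intro: step_reduced)
    have "walk m [?x, ?z] s k = [?x] \<longleftrightarrow> walk m [] s k = [flip ?z]" for k
    proof -
      have redw: "reduced_word (walk m [] s k)" using reds by (intro walk_reduced) auto
      have "walk m [?x, ?z] s k = push ?x (push ?z (walk m [] s k))"
        using walk_translate[OF red reds] by simp
      moreover have "[?x] = push ?x (push ?z [flip ?z])" by (simp add: push_def)
      ultimately show ?thesis
        using redw by (simp add: push_eq_iff reduced_push reduced_Cons)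
    qed
    then show ?case by simp
  qed
  then have "\<P>(s in steps \<mu>. ?miss s) = \<P>(s in steps \<mu>. \<not> (\<exists>k. walk m [] s k = [flip ?z]))"
    by (intro prob_eq_AE) measurable
  also have "\<dots> = 1 - passage (flip ?z)"
    unfolding first_passage_eq_prob_hit by (rule prob_neg) measurable
  finally have P_miss: "\<P>(s in steps \<mu>. ?miss s) > 0"
    using passage_less_1[OF z] passage_flip[of ?z] by simp
  have first: "Measurable.pred (steps \<mu>) (\<lambda>s. s 0 = [?x, ?z])"
    by (rule measurable_compose[OF measurable_step]) simp
  have "\<P>(s in steps \<mu>. s 0 = [?x, ?z] \<and> ?miss (\<lambda>n. s (1 + n))) = 
      \<P>(s in steps \<mu>. s 0 = [?x, ?z]) * \<P>(s in steps \<mu>. ?miss s)"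
    using first miss by (rule markov) simp
  also have "\<dots> > 0"
    using P_miss unfolding prob_first_step by (cases c) (simp_all add: pmf_positive support_eq)
  finally have "0 < \<P>(s in steps \<mu>. s 0 = [?x, ?z] \<and> ?miss (\<lambda>n. s (1 + n)))" .
  also have "\<dots> \<le> \<P>(s in steps \<mu>. \<not> (\<exists>k. walk m [] s k = [?x]) \<and> cone_limit ?x (walk m [] s))"
  proof (rule finite_measure_mono_AE)
    show "AE s in steps \<mu>. s \<in> {s \<in> space (steps \<mu>). s 0 = [?x, ?z] \<and> ?miss (\<lambda>n. s (1 + n))} \<longrightarrow>
        s \<in> {s \<in> space (steps \<mu>). \<not> (\<exists>k. walk m [] s k = [?x]) \<and> cone_limit ?x (walk m [] s)}"
      using AE_steps_in_support
    proof eventually_elim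
      case (elim s)
      show ?case
      proof
        assume "s \<in> {s \<in> space (steps \<mu>). s 0 = [?x, ?z] \<and> ?miss (\<lambda>n. s (1 + n))}"
        then have s0: "s 0 = [?x, ?z]" and ms: "?miss (\<lambda>n. s (1 + n))" by auto
        have w: "walk m [] s (Suc n) = walk m [?x, ?z] (\<lambda>n. s (1 + n)) n" for n
          using walk_shift[of m "[]" s 1 n] s0 red by (simp add: mult_Nil)
        have "walk m [] s k \<noteq> [?x]" for k
          using ms w by (cases k) (auto simp del: walk.simps(2))
        moreover have "prefix [?x, ?z] (walk m [] s (Suc n))" for n
        proof (induction n)
          case 0
          then show ?case using w[of 0] by simp
        next
          case (Suc n)
          have "reduced_word (walk m [] s (Suc n))" 
            using elim by (intro walk_reduced) (auto intro: step_reduced)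
          then show ?case
            using leave_cone_step[OF _ _ Suc, of "s (Suc n)"] calculation[of "Suc (Suc n)"] elim by simp
        qed
        then have "prefix [?x] (walk m [] s k)" if "k \<ge> 1" for k
          using that prefix_order.trans[of "[?x]" "[?x, ?z]"] by (cases k) (auto simp del: walk.simps(2))
        then have "cone_limit ?x (walk m [] s)"
          unfolding cone_limit_def eventually_sequentially by blast
        ultimately show "s \<in> {s \<in> space (steps \<mu>). \<not> (\<exists>k. walk m [] s k = [?x]) \<and> cone_limit ?x (walk m [] s)}"
          by simp
      qed
    qed
  qed measurable
  also have "\<dots> = cone_measure ?x - 
     \<P>(s in steps \<mu>. (\<exists>k. walk m [] s k = [?x]) \<and> cone_limit ?x (walk m [] s))"
  proof -
    let ?A = "{s \<in> space (steps \<mu>). (\<exists>k. walk m [] s k = [?x]) \<and> cone_limit ?x (walk m [] s)}"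
    let ?L = "{s \<in> space (steps \<mu>). cone_limit ?x (walk m [] s)}"
    have "?A \<in> sets (steps \<mu>)" "?L \<in> sets (steps \<mu>)" by measurable
    then have "measure (steps \<mu>) (?L - ?A) = measure (steps \<mu>) ?L - measure (steps \<mu>) ?A"
      by (intro finite_measure_Diff) auto
    moreover have "?L - ?A = {s \<in> space (steps \<mu>). \<not> (\<exists>k. walk m [] s k = [?x]) \<and> cone_limit ?x (walk m [] s)}"
      by auto
    ultimately show ?thesis unfolding cone_measure_def by simp
  qed
  finally show ?thesis unfolding prob_visit_and_cone_limit by simp
qed

section \<open>Powers of a letter and the final inequality\<close>

text \<open>The first visit to \<open>x\<close> precedes every visit to a positive power of \<open>x\<close>; restarting there and translating
  leaves one power less.\<close>
lemma first_passage_power: "first_passage m \<mu> [] (replicate n x) = passage x ^ n"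
proof (induction n)
  case 0
  interpret prob_space "steps \<mu>" by (rule prob_space_steps)
  have "\<exists>k. walk m [] s k = []" for s by (rule exI[of _ 0]) simp
  then show ?case using prob_space by (simp add: first_passage_eq_prob_hit)
next
  case (Suc n)
  interpret prob_space "steps \<mu>" by (rule prob_space_steps)
  let ?p = "replicate (Suc n) x"
  have not_before: "\<not> before_letter x ?p"
    by (cases n; cases x) (auto simp: before_letter_def)
  have "AE s in steps \<mu>. (\<exists>k. walk m [] s k = ?p) \<longleftrightarrow> 
      (\<exists>k. walk m [] s k = [x]) \<and> (\<exists>k. walk m [] s k = ?p)"
    using AE_steps_in_support
  proof eventually_elim
    case (elim s)
    have "\<exists>k. walk m [] s k = [x]" if "walk m [] s k = ?p" for k
      using visits_letter[of s x k] elim not_before that by auto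
    then show ?case by blast
  qed
  then have "first_passage m \<mu> [] ?p = 
      \<P>(s in steps \<mu>. (\<exists>k. walk m [] s k = [x]) \<and> (\<exists>k. walk m [] s k = ?p))"
    unfolding first_passage_eq_prob_hit by (intro prob_eq_AE) measurable
  also have "\<dots> = passage x * \<P>(s in steps \<mu>. \<exists>k. walk m [x] s k = ?p)"
  proof (rule strong_markov)
    fix s k
    assume s: "\<And>i. s i \<in> set_pmf \<mu>" and k: "walk m [] s k = [x]" "\<And>j. j < k \<Longrightarrow> walk m [] s j \<noteq> [x]"
    have w: "walk m [] s (k + i) = walk m [x] (\<lambda>n. s (k + n)) i" for i
      using walk_shift[of m "[]" s k i] k(1) by simp
    \<comment> \<open>No visit to the power is lost by restarting, since none occurs before the first visit to \<open>x\<close>.\<close>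
    have "k \<le> i" if "walk m [] s i = ?p" for i
      using visits_letter[of s x i, OF s] not_before that k(2) by (metis leD le_trans not_le_imp_less)
    then have "\<exists>j. walk m [x] (\<lambda>n. s (k + n)) j = ?p" if "walk m [] s i = ?p" for i
      using that w[of "i - k"] by (intro exI[of _ "i - k"]) simp
    moreover have "\<exists>i. walk m [] s i = ?p" if "walk m [x] (\<lambda>n. s (k + n)) j = ?p" for j
      using that w[of j] by (intro exI[of _ "k + j"]) simp
    ultimately show "(\<exists>i. walk m [] s i = ?p) \<longleftrightarrow> (\<exists>j. walk m [x] (\<lambda>n. s (k + n)) j = ?p)"
      by blast
  qed measurable
  also have "\<P>(s in steps \<mu>. \<exists>k. walk m [x] s k = ?p) = first_passage m \<mu> [] (replicate n x)"
    unfolding first_passage_eq_prob_hit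
  proof (rule prob_eq_AE)
    show "AE s in steps \<mu>. (\<exists>k. walk m [x] s k = ?p) \<longleftrightarrow> (\<exists>k. walk m [] s k = replicate n x)"
      using AE_steps_in_support
    proof eventually_elim
      case (elim s)
      then have reds: "reduced_word (s k)" for k by (auto intro: step_reduced)
      have "walk m [x] s k = push x (walk m [] s k)" for k
        using walk_translate[of "[x]" s m k] reds by (simp add: reduced_Cons)
      moreover have "?p = push x (replicate n x)"
        using reduced_replicate[of "Suc n" x] by (simp add: push_reduced_Cons)
      moreover have "reduced_word (walk m [] s k)" for k using reds by (intro walk_reduced) auto
      ultimately show ?case by (simp add: push_eq_iff reduced_replicate)
    qed
  qed measurable
  finally show ?case using Suc by simp
qed

lemma rho_letter: "rho m \<mu> [x] = passage x"
proof -
  have "passage x \<ge> 0" by (simp add: first_passage_eq_prob_hit)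
  then have "\<forall>\<^sub>F k in sequentially. 
      ereal (root k (first_passage m \<mu> [] ([x] [^]\<^bsub>free_group m\<^esub> k))) = ereal (passage x)"
    unfolding eventually_sequentially 
    by (intro exI[of _ 1]) (auto simp: pow_letter first_passage_power real_root_power_cancel)
  then have "(\<lambda>k. ereal (root k (first_passage m \<mu> [] ([x] [^]\<^bsub>free_group m\<^esub> k)))) \<longlonglongrightarrow> ereal (passage x)"
    by (rule tendsto_eventually)
  from lim_imp_Liminf[OF sequentially_bot this] show ?thesis by (simp add: rho_def)
qed

lemma passage_eq_quotient: "fst x \<noteq> 1 \<Longrightarrow> passage x = cone_measure x / (1 - cone_measure x)"
  using cone_measure_eq_passage[of x] cone_measure_half[of x] by (simp add: eq_divide_eq)

lemma passage_less_quotient: "fst x = 1 \<Longrightarrow> passage x < cone_measure x / (1 - cone_measure x)"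
  using cone_measure_gt_passage[of "snd x"] cone_measure_half[of x] by (cases x) (simp add: less_divide_eq)

text \<open>The summands of the final inequality are the solutions \<open>\<nu>\<close> of \<open>F = \<nu>/(1 - \<nu>)\<close>.\<close>
lemma odds_le_cone_measure:
  assumes "x \<in> letters m"
  shows "1 / (1 + inverse (passage x)) \<le> cone_measure x"
    and "fst x = 1 \<Longrightarrow> 1 / (1 + inverse (passage x)) < cone_measure x"
proof -
  have p: "passage x > 0" using passage_pos[OF assms] .
  have eq: "1 / (1 + inverse (passage x)) = passage x / (1 + passage x)"
    using p by (simp add: field_simps)
  show "1 / (1 + inverse (passage x)) \<le> cone_measure x"
    unfolding eq using cone_measure_ge_passage[of x] p by (simp add: divide_le_eq algebra_simps)
  assume "fst x = 1"
  then have "passage x * (1 - cone_measure x) < cone_measure x" 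
    using cone_measure_gt_passage[of "snd x"] by (cases x) simp
  then show "1 / (1 + inverse (passage x)) < cone_measure x"
    unfolding eq using p by (simp add: divide_less_eq algebra_simps)
qed

lemma sum_odds_less_1:
  "(\<Sum>i=1..m. 1 / (1 + inverse (passage (i, True))) + 1 / (1 + inverse (passage (i, False)))) < 1"
proof -
  have let_i: "(i, b) \<in> letters m" if "i \<in> {1..m}" for i b using that by (simp add: letters_iff)
  have "(\<Sum>i=1..m. 1 / (1 + inverse (passage (i, True))) + 1 / (1 + inverse (passage (i, False))))
     < (\<Sum>i=1..m. cone_measure (i, True) + cone_measure (i, False))"
  proof (rule sum_strict_mono_ex1)
    show "\<forall>i\<in>{1..m}. 1 / (1 + inverse (passage (i, True))) + 1 / (1 + inverse (passage (i, False))) \<le>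
        cone_measure (i, True) + cone_measure (i, False)"
      by (intro ballI add_mono odds_le_cone_measure(1) let_i)
    have one: "1 \<in> {1..m}" using two_le_rank by simp
    show "\<exists>i\<in>{1..m}. 1 / (1 + inverse (passage (i, True))) + 1 / (1 + inverse (passage (i, False))) <
        cone_measure (i, True) + cone_measure (i, False)"
      by (rule bexI[OF _ one], intro add_strict_mono odds_le_cone_measure(2) let_i one) simp_all
  qed simp
  also have "\<dots> = (\<Sum>x\<in>letters m. cone_measure x)"
    by (simp add: letters_def sum.cartesian_product' UNIV_bool add.commute)
  also have "\<dots> \<le> 1" by (rule sum_cone_measure_le_1) (simp add: letters_def)
  finally show ?thesis .
qed

end

theorem corollary1p2:
  fixes m :: nat and \<mu> :: "word pmf"
  assumes "m \<ge> 2"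
    and "set_pmf \<mu> =
           (\<Union>i\<in>{1..m}. {gen i, inv\<^bsub>free_group m\<^esub> (gen i)}) \<union>
           {gen 1 \<otimes>\<^bsub>free_group m\<^esub> gen 2,
            inv\<^bsub>free_group m\<^esub> (gen 1) \<otimes>\<^bsub>free_group m\<^esub> inv\<^bsub>free_group m\<^esub> (gen 2)}"
    and "antisymmetric m \<mu>"
  shows "(rho m \<mu> (gen 1) = first_passage m \<mu> \<one>\<^bsub>free_group m\<^esub> (gen 1) \<and>
          first_passage m \<mu> \<one>\<^bsub>free_group m\<^esub> (gen 1) <
            measure (hitting_measure m \<mu>) (cylinder m (gen 1)) /
            (1 - measure (hitting_measure m \<mu>) (cylinder m (gen 1)))) \<and>
         (\<forall>j\<in>{2..m}.
           rho m \<mu> (gen j) = first_passage m \<mu> \<one>\<^bsub>free_group m\<^esub> (gen j) \<and>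
           first_passage m \<mu> \<one>\<^bsub>free_group m\<^esub> (gen j) =
             measure (hitting_measure m \<mu>) (cylinder m (gen j)) /
             (1 - measure (hitting_measure m \<mu>) (cylinder m (gen j)))) \<and>
         \<not> (\<Sum>i=1..m. 1 / (1 + inverse (rho m \<mu> (gen i))) +
                      1 / (1 + inverse (rho m \<mu> (inv\<^bsub>free_group m\<^esub> (gen i))))) \<ge> 1"
proof -
  interpret antisymmetric_walk m \<mu>
    using assms by unfold_locales
  have cyl: "measure (hitting_measure m \<mu>) (cylinder m (gen i)) = cone_measure (i, True)" if "i \<in> {1..m}" for i
    using that by (simp add: gen_def measure_cylinder letters_iff)
  have rho: "rho m \<mu> (gen i) = passage (i, True)" for i
    by (simp add: gen_def rho_letter)
  have rho_inv: "rho m \<mu> (inv\<^bsub>free_group m\<^esub> (gen i)) = passage (i, False)" if "i \<in> {1..m}" for i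
    using that inv_letter[of "(i, True)" m] by (simp add: gen_def rho_letter letters_iff flip_def)
  have "(\<Sum>i=1..m. 1 / (1 + inverse (rho m \<mu> (gen i))) + 1 / (1 + inverse (rho m \<mu> (inv\<^bsub>free_group m\<^esub> (gen i))))) < 1"
    using sum_odds_less_1 by (simp add: rho rho_inv)
  moreover have "1 \<in> {1..m}" using two_le_rank by simp
  moreover have "first_passage m \<mu> [] (gen i) = passage (i, True)" for i by (simp add: gen_def)
  ultimately show ?thesis
    using passage_less_quotient[of "(1, True)"] passage_eq_quotient[of "(_, True)"]
    by (simp add: rho cyl not_le)
qed

end
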